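(* Let $R$ be an associative ring with unit and let $M$ be a left $R$-module which is $M^{(\Lambda)}$-projective for every index set $\Lambda$ and retractable. If $M$ is a Goldie module, then the prime radical $N$ of $M$ is a nilpotent submodule of $M$, i.e. $N^\ell=0$ for some integer $\ell>0$.
   Context: Modules are unitary left modules; $S=\operatorname{End}_R(M)$. $M^{(\Lambda)}$ is the direct sum of copies of $M$ indexed by $\Lambda$. A module $M$ is $L$-projective if for every epimorphism $\rho:L\to L'$ and every homomorphism $\alpha:M\to L'$ there is $\overline{\alpha}:M\to L$ with $\rho\overline{\alpha}=\alpha$. $M$ is retractable if $\operatorname{Hom}_R(M,K)\neq 0$ for every nonzero submodule $K$ of $M$. $M$ is Goldie if the set $\{\bigcap_{f\in X}\operatorname{Ker} f\mid X\subseteq S\}$ satisfies the ascending chain condition and $M$ has finite uniform dimension. A submodule $N\leq M$ is fully invariant if $f(N)\subseteq N$ for all $f\in S$. For submodules $A,B\leq M$ the product is $A_MB=\sum\{f(A)\mid f\in\operatorname{Hom}_R(M,B)\}$. Powers: $N^1=N$ and $N^{\ell+1}=(N^\ell)_MN$. A fully invariant submodule $P$ of $M$ is a prime submodule if, for all fully invariant submodules $A,B$ of $M$, $A_MB\leq P$ implies $A\leq P$ or $B\leq P$. The prime radical of $M$ is the intersection of all prime submodules of $M$. *)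

theory Defs
  imports "HOL-Algebra.Module" "HOL-Library.Countable_Set"
begin

section \<open>Left modules over an associative ring with unit\<close>

text \<open>The locale \<^locale>\<open>module\<close> of HOL-Algebra requires a commutative ring of scalars.  The
  following one has the same axioms over an arbitrary \<^locale>\<open>ring\<close>; it uses the same record type,
  of which the fields \<open>mult\<close> and \<open>one\<close> play no role, and the same notion of
  \<^locale>\<open>submodule\<close>.\<close>

locale left_module = R?: ring R + M?: abelian_group M
  for R (structure) and M (structure) +
  assumes smult_closed [simp, intro]:
      "\<lbrakk>a \<in> carrier R; x \<in> carrier M\<rbrakk> \<Longrightarrow> a \<odot>\<^bsub>M\<^esub> x \<in> carrier M"
    and smult_l_distr:
      "\<lbrakk>a \<in> carrier R; b \<in> carrier R; x \<in> carrier M\<rbrakk> \<Longrightarrow>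
      (a \<oplus> b) \<odot>\<^bsub>M\<^esub> x = a \<odot>\<^bsub>M\<^esub> x \<oplus>\<^bsub>M\<^esub> b \<odot>\<^bsub>M\<^esub> x"
    and smult_r_distr:
      "\<lbrakk>a \<in> carrier R; x \<in> carrier M; y \<in> carrier M\<rbrakk> \<Longrightarrow>
      a \<odot>\<^bsub>M\<^esub> (x \<oplus>\<^bsub>M\<^esub> y) = a \<odot>\<^bsub>M\<^esub> x \<oplus>\<^bsub>M\<^esub> a \<odot>\<^bsub>M\<^esub> y"
    and smult_assoc1:
      "\<lbrakk>a \<in> carrier R; b \<in> carrier R; x \<in> carrier M\<rbrakk> \<Longrightarrow>
      (a \<otimes> b) \<odot>\<^bsub>M\<^esub> x = a \<odot>\<^bsub>M\<^esub> (b \<odot>\<^bsub>M\<^esub> x)"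
    and smult_one [simp]:
      "x \<in> carrier M \<Longrightarrow> \<one> \<odot>\<^bsub>M\<^esub> x = x"

text \<open>Values of a homomorphism outside the carrier are unspecified.\<close>

definition lmod_hom ::
  "('r, 'x) ring_scheme \<Rightarrow> ('r, 'm, 'y) module_scheme \<Rightarrow> ('r, 'n, 'z) module_scheme \<Rightarrow> ('m \<Rightarrow> 'n) set"
  where "lmod_hom R M N = {f \<in> carrier M \<rightarrow> carrier N.
    (\<forall>x\<in>carrier M. \<forall>y\<in>carrier M. f (x \<oplus>\<^bsub>M\<^esub> y) = f x \<oplus>\<^bsub>N\<^esub> f y) \<and>
    (\<forall>a\<in>carrier R. \<forall>x\<in>carrier M. f (a \<odot>\<^bsub>M\<^esub> x) = a \<odot>\<^bsub>N\<^esub> f x)}"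

definition lmod_epi ::
  "('r, 'x) ring_scheme \<Rightarrow> ('r, 'm, 'y) module_scheme \<Rightarrow> ('r, 'n, 'z) module_scheme \<Rightarrow> ('m \<Rightarrow> 'n) set"
  where "lmod_epi R M N = {f \<in> lmod_hom R M N. f ` carrier M = carrier N}"

abbreviation lmod_end :: "('r, 'x) ring_scheme \<Rightarrow> ('r, 'm, 'y) module_scheme \<Rightarrow> ('m \<Rightarrow> 'm) set"
  where "lmod_end R M \<equiv> lmod_hom R M M"

definition submodule_sum ::
  "('r, 'm, 'y) module_scheme \<Rightarrow> 'i set \<Rightarrow> ('i \<Rightarrow> 'm set) \<Rightarrow> 'm set"
  where "submodule_sum M I A =
    {\<Oplus>\<^bsub>M\<^esub>i\<in>F. x i | F x. finite F \<and> F \<subseteq> I \<and> (\<forall>i\<in>F. x i \<in> A i)}"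

section \<open>Direct powers, projectivity and retractability\<close>

definition direct_power :: "('r, 'm, 'y) module_scheme \<Rightarrow> 'i set \<Rightarrow> ('r, 'i \<Rightarrow> 'm) module"
  where "direct_power M \<Lambda> =
    \<lparr>carrier = {z \<in> \<Lambda> \<rightarrow>\<^sub>E carrier M. finite {i \<in> \<Lambda>. z i \<noteq> \<zero>\<^bsub>M\<^esub>}},
     mult = undefined, one = undefined,
     zero = (\<lambda>i\<in>\<Lambda>. \<zero>\<^bsub>M\<^esub>),
     add = (\<lambda>z w. \<lambda>i\<in>\<Lambda>. z i \<oplus>\<^bsub>M\<^esub> w i),
     smult = (\<lambda>a z. \<lambda>i\<in>\<Lambda>. a \<odot>\<^bsub>M\<^esub> z i)\<rparr>"

text \<open>Every epimorphic image of \<open>L\<close> is isomorphic to a quotient of \<open>L\<close>, whose elements are subsets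
  of \<open>L\<close>.  So it is no restriction that the codomain \<open>L'\<close> has carrier type \<^typ>\<open>'l set\<close>.\<close>

definition rel_projective ::
  "('r, 'x) ring_scheme \<Rightarrow> ('r, 'm, 'y) module_scheme \<Rightarrow> ('r, 'l, 'z) module_scheme \<Rightarrow> bool"
  where "rel_projective R M L \<longleftrightarrow>
    (\<forall>(L' :: ('r, 'l set) module) \<rho> \<alpha>.
      left_module R L' \<and> \<rho> \<in> lmod_epi R L L' \<and> \<alpha> \<in> lmod_hom R M L' \<longrightarrow>
      (\<exists>\<beta> \<in> lmod_hom R M L. \<forall>x\<in>carrier M. \<rho> (\<beta> x) = \<alpha> x))"

text \<open>\<open>M\<close> is projective relative to all its direct powers.  HOL cannot quantify over the type of the
  index set inside a formula; \<open>direct_power_projective_lift\<close> below shows that index sets over the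
  type \<^typ>\<open>'m \<times> nat\<close> yield the lifting property for index sets of every type
  and for epimorphisms onto modules of every type.\<close>

definition direct_power_projective ::
  "('r, 'x) ring_scheme \<Rightarrow> ('r, 'm, 'y) module_scheme \<Rightarrow> bool"
  where "direct_power_projective R M \<longleftrightarrow>
    (\<forall>\<Lambda> :: ('m \<times> nat) set. rel_projective R M (direct_power M \<Lambda>))"

definition retractable :: "('r, 'x) ring_scheme \<Rightarrow> ('r, 'm, 'y) module_scheme \<Rightarrow> bool"
  where "retractable R M \<longleftrightarrow>
    (\<forall>K. submodule K R M \<and> K \<noteq> {\<zero>\<^bsub>M\<^esub>} \<longrightarrow>
      (\<exists>f \<in> lmod_hom R M (M\<lparr>carrier := K\<rparr>). \<exists>x\<in>carrier M. f x \<noteq> \<zero>\<^bsub>M\<^esub>))"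

section \<open>Goldie modules\<close>

definition essential_submodule ::
  "'m set \<Rightarrow> ('r, 'x) ring_scheme \<Rightarrow> ('r, 'm, 'y) module_scheme \<Rightarrow> bool"
  where "essential_submodule E R M \<longleftrightarrow> submodule E R M \<and>
    (\<forall>K. submodule K R M \<and> K \<noteq> {\<zero>\<^bsub>M\<^esub>} \<longrightarrow> E \<inter> K \<noteq> {\<zero>\<^bsub>M\<^esub>})"

definition uniform_submodule ::
  "'m set \<Rightarrow> ('r, 'x) ring_scheme \<Rightarrow> ('r, 'm, 'y) module_scheme \<Rightarrow> bool"
  where "uniform_submodule U R M \<longleftrightarrow> submodule U R M \<and> U \<noteq> {\<zero>\<^bsub>M\<^esub>} \<and>
    (\<forall>A B. submodule A R M \<and> A \<subseteq> U \<and> A \<noteq> {\<zero>\<^bsub>M\<^esub>} \<and>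
      submodule B R M \<and> B \<subseteq> U \<and> B \<noteq> {\<zero>\<^bsub>M\<^esub>} \<longrightarrow> A \<inter> B \<noteq> {\<zero>\<^bsub>M\<^esub>})"

text \<open>The uniform dimension of \<open>M\<close> is \<open>n\<close> if \<open>M\<close> has an essential submodule which is the (internal)
  direct sum of \<open>n\<close> uniform submodules.\<close>

definition has_uniform_dimension ::
  "('r, 'x) ring_scheme \<Rightarrow> ('r, 'm, 'y) module_scheme \<Rightarrow> nat \<Rightarrow> bool"
  where "has_uniform_dimension R M n \<longleftrightarrow>
    (\<exists>U :: nat \<Rightarrow> 'm set.
      (\<forall>i<n. uniform_submodule (U i) R M) \<and>
      (\<forall>i<n. U i \<inter> submodule_sum M ({..<n} - {i}) U = {\<zero>\<^bsub>M\<^esub>}) \<and>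
      essential_submodule (submodule_sum M {..<n} U) R M)"

definition finite_uniform_dimension ::
  "('r, 'x) ring_scheme \<Rightarrow> ('r, 'm, 'y) module_scheme \<Rightarrow> bool"
  where "finite_uniform_dimension R M \<longleftrightarrow> (\<exists>n. has_uniform_dimension R M n)"

text \<open>The intersection of the empty family of kernels is the whole module.\<close>

definition kernel_intersections ::
  "('r, 'x) ring_scheme \<Rightarrow> ('r, 'm, 'y) module_scheme \<Rightarrow> 'm set set"
  where "kernel_intersections R M =
    {{x \<in> carrier M. \<forall>f\<in>X. f x = \<zero>\<^bsub>M\<^esub>} | X. X \<subseteq> lmod_end R M}"

definition ascending_chain_condition :: "'m set set \<Rightarrow> bool"
  where "ascending_chain_condition \<F> \<longleftrightarrow>
    (\<forall>C :: nat \<Rightarrow> 'm set. (\<forall>n. C n \<in> \<F>) \<and> (\<forall>n. C n \<subseteq> C (Suc n)) \<longrightarrow>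
      (\<exists>n. \<forall>m\<ge>n. C m = C n))"

definition goldie_module :: "('r, 'x) ring_scheme \<Rightarrow> ('r, 'm, 'y) module_scheme \<Rightarrow> bool"
  where "goldie_module R M \<longleftrightarrow>
    ascending_chain_condition (kernel_intersections R M) \<and> finite_uniform_dimension R M"

section \<open>Products of submodules and the prime radical\<close>

definition fully_invariant ::
  "'m set \<Rightarrow> ('r, 'x) ring_scheme \<Rightarrow> ('r, 'm, 'y) module_scheme \<Rightarrow> bool"
  where "fully_invariant N R M \<longleftrightarrow> submodule N R M \<and> (\<forall>f \<in> lmod_end R M. f ` N \<subseteq> N)"

definition submodule_prod ::
  "('r, 'x) ring_scheme \<Rightarrow> ('r, 'm, 'y) module_scheme \<Rightarrow> 'm set \<Rightarrow> 'm set \<Rightarrow> 'm set"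
  where "submodule_prod R M A B =
    submodule_sum M (lmod_hom R M (M\<lparr>carrier := B\<rparr>)) (\<lambda>f. f ` A)"

text \<open>Powers are only meaningful for positive exponents; the value at \<open>0\<close> is a convention.\<close>

fun submodule_power ::
  "('r, 'x) ring_scheme \<Rightarrow> ('r, 'm, 'y) module_scheme \<Rightarrow> 'm set \<Rightarrow> nat \<Rightarrow> 'm set"
  where
    "submodule_power R M N 0 = carrier M"
  | "submodule_power R M N (Suc 0) = N"
  | "submodule_power R M N (Suc (Suc l)) = submodule_prod R M (submodule_power R M N (Suc l)) N"

definition nilpotent_submodule ::
  "'m set \<Rightarrow> ('r, 'x) ring_scheme \<Rightarrow> ('r, 'm, 'y) module_scheme \<Rightarrow> bool"
  where "nilpotent_submodule N R M \<longleftrightarrow> submodule N R M \<and>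
    (\<exists>l>0. submodule_power R M N l = {\<zero>\<^bsub>M\<^esub>})"

text \<open>A prime submodule is not required to be proper, so \<open>M\<close> itself is always one.  This does not
  affect the prime radical, except that \<open>M\<close> is then the value when there is no proper prime
  submodule, in agreement with the usual convention.\<close>

definition prime_submodule ::
  "'m set \<Rightarrow> ('r, 'x) ring_scheme \<Rightarrow> ('r, 'm, 'y) module_scheme \<Rightarrow> bool"
  where "prime_submodule P R M \<longleftrightarrow> fully_invariant P R M \<and>
    (\<forall>A B. fully_invariant A R M \<and> fully_invariant B R M \<and> submodule_prod R M A B \<subseteq> P \<longrightarrow>
      A \<subseteq> P \<or> B \<subseteq> P)"

definition prime_radical :: "('r, 'x) ring_scheme \<Rightarrow> ('r, 'm, 'y) module_scheme \<Rightarrow> 'm set"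
  where "prime_radical R M = \<Inter>{P. prime_submodule P R M}"

section \<open>Index sets of arbitrary type\<close>

lemma (in left_module) smult_zero_left:
  assumes "x \<in> carrier M"
  shows "\<zero> \<odot>\<^bsub>M\<^esub> x = \<zero>\<^bsub>M\<^esub>"
proof -
  have "\<zero> \<odot>\<^bsub>M\<^esub> x = \<zero> \<odot>\<^bsub>M\<^esub> x \<oplus>\<^bsub>M\<^esub> \<zero> \<odot>\<^bsub>M\<^esub> x"
    using smult_l_distr[of \<zero> \<zero> x] assms by simp
  then show ?thesis
    using assms by (metis M.add.r_cancel_one' R.zero_closed smult_closed)
qed

lemma (in left_module) smult_zero_right:
  assumes "a \<in> carrier R"
  shows "a \<odot>\<^bsub>M\<^esub> \<zero>\<^bsub>M\<^esub> = \<zero>\<^bsub>M\<^esub>"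
proof -
  have "a \<odot>\<^bsub>M\<^esub> \<zero>\<^bsub>M\<^esub> = a \<odot>\<^bsub>M\<^esub> \<zero>\<^bsub>M\<^esub> \<oplus>\<^bsub>M\<^esub> a \<odot>\<^bsub>M\<^esub> \<zero>\<^bsub>M\<^esub>"
    using smult_r_distr[of a "\<zero>\<^bsub>M\<^esub>" "\<zero>\<^bsub>M\<^esub>"] assms by simp
  then show ?thesis
    using assms by (metis M.add.r_cancel_one' M.zero_closed smult_closed)
qed

lemma left_moduleI:
  fixes R (structure) and M (structure)
  assumes "ring R" and "abelian_group M"
    and "\<And>a x. \<lbrakk>a \<in> carrier R; x \<in> carrier M\<rbrakk> \<Longrightarrow> a \<odot>\<^bsub>M\<^esub> x \<in> carrier M"
    and "\<And>a b x. \<lbrakk>a \<in> carrier R; b \<in> carrier R; x \<in> carrier M\<rbrakk> \<Longrightarrow>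
      (a \<oplus> b) \<odot>\<^bsub>M\<^esub> x = a \<odot>\<^bsub>M\<^esub> x \<oplus>\<^bsub>M\<^esub> b \<odot>\<^bsub>M\<^esub> x"
    and "\<And>a x y. \<lbrakk>a \<in> carrier R; x \<in> carrier M; y \<in> carrier M\<rbrakk> \<Longrightarrow>
      a \<odot>\<^bsub>M\<^esub> (x \<oplus>\<^bsub>M\<^esub> y) = a \<odot>\<^bsub>M\<^esub> x \<oplus>\<^bsub>M\<^esub> a \<odot>\<^bsub>M\<^esub> y"
    and "\<And>a b x. \<lbrakk>a \<in> carrier R; b \<in> carrier R; x \<in> carrier M\<rbrakk> \<Longrightarrow>
      (a \<otimes> b) \<odot>\<^bsub>M\<^esub> x = a \<odot>\<^bsub>M\<^esub> (b \<odot>\<^bsub>M\<^esub> x)"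
    and "\<And>x. x \<in> carrier M \<Longrightarrow> \<one> \<odot>\<^bsub>M\<^esub> x = x"
  shows "left_module R M"
  using assms by (intro left_module.intro left_module_axioms.intro)

lemma (in left_module) left_module_direct_power: "left_module R (direct_power M \<Lambda>)"
proof (intro left_moduleI abelian_groupI R.ring_axioms)
  let ?P = "direct_power M \<Lambda>"
  show "z \<oplus>\<^bsub>?P\<^esub> w \<in> carrier ?P" if "z \<in> carrier ?P" "w \<in> carrier ?P" for z w
  proof -
    have "finite {i \<in> \<Lambda>. (z \<oplus>\<^bsub>?P\<^esub> w) i \<noteq> \<zero>\<^bsub>M\<^esub>}"
      by (rule finite_subset[of _ "{i \<in> \<Lambda>. z i \<noteq> \<zero>\<^bsub>M\<^esub>} \<union> {i \<in> \<Lambda>. w i \<noteq> \<zero>\<^bsub>M\<^esub>}"])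
         (use that in \<open>auto simp: direct_power_def\<close>)
    then show ?thesis using that by (auto simp: direct_power_def PiE_iff)
  qed
  show "\<zero>\<^bsub>?P\<^esub> \<in> carrier ?P"
    by (auto simp: direct_power_def PiE_iff cong: conj_cong)
  show smc: "a \<odot>\<^bsub>?P\<^esub> z \<in> carrier ?P" if "a \<in> carrier R" "z \<in> carrier ?P" for a z
  proof -
    have "finite {i \<in> \<Lambda>. (a \<odot>\<^bsub>?P\<^esub> z) i \<noteq> \<zero>\<^bsub>M\<^esub>}"
      by (rule finite_subset[of _ "{i \<in> \<Lambda>. z i \<noteq> \<zero>\<^bsub>M\<^esub>}"])
         (use that in \<open>auto simp: direct_power_def smult_zero_right\<close>)
    then show ?thesis using that by (auto simp: direct_power_def PiE_iff)
  qed
  show "\<exists>y\<in>carrier ?P. y \<oplus>\<^bsub>?P\<^esub> z = \<zero>\<^bsub>?P\<^esub>" if "z \<in> carrier ?P" for z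
  proof (rule bexI[of _ "(\<ominus>\<one>) \<odot>\<^bsub>?P\<^esub> z"])
    have "(\<ominus>\<one>) \<odot>\<^bsub>M\<^esub> x \<oplus>\<^bsub>M\<^esub> x = \<zero>\<^bsub>M\<^esub>" if "x \<in> carrier M" for x
      using smult_l_distr[of "\<ominus>\<one>" \<one> x] that by (simp add: R.l_neg smult_zero_left)
    then show "(\<ominus>\<one>) \<odot>\<^bsub>?P\<^esub> z \<oplus>\<^bsub>?P\<^esub> z = \<zero>\<^bsub>?P\<^esub>"
      using that by (auto simp: direct_power_def PiE_iff fun_eq_iff)
    show "(\<ominus>\<one>) \<odot>\<^bsub>?P\<^esub> z \<in> carrier ?P" using that smc by simp
  qed
qed (auto simp: direct_power_def PiE_iff fun_eq_iff extensional_def M.add.m_ac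
      smult_l_distr smult_r_distr smult_assoc1 Pi_def)

lemma left_module_transport:
  fixes T :: "('r, 't, 'z) module_scheme"
  assumes "left_module R L"
    and bij: "bij_betw h (carrier T) (carrier L)"
    and zero: "\<zero>\<^bsub>T\<^esub> \<in> carrier T" "h \<zero>\<^bsub>T\<^esub> = \<zero>\<^bsub>L\<^esub>"
    and add: "\<And>x y. \<lbrakk>x \<in> carrier T; y \<in> carrier T\<rbrakk> \<Longrightarrow>
      x \<oplus>\<^bsub>T\<^esub> y \<in> carrier T \<and> h (x \<oplus>\<^bsub>T\<^esub> y) = h x \<oplus>\<^bsub>L\<^esub> h y"
    and smult: "\<And>a x. \<lbrakk>a \<in> carrier R; x \<in> carrier T\<rbrakk> \<Longrightarrow>
      a \<odot>\<^bsub>T\<^esub> x \<in> carrier T \<and> h (a \<odot>\<^bsub>T\<^esub> x) = a \<odot>\<^bsub>L\<^esub> h x"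
  shows "left_module R T"
proof -
  interpret L: left_module R L by fact
  have hc: "h x \<in> carrier L" if "x \<in> carrier T" for x
    using bij that by (auto simp: bij_betw_def)
  have inj: "x = y" if "x \<in> carrier T" "y \<in> carrier T" "h x = h y" for x y
    using bij that by (auto simp: bij_betw_def inj_on_def)
  show ?thesis
  proof (intro left_moduleI abelian_groupI)
    show "\<exists>y\<in>carrier T. y \<oplus>\<^bsub>T\<^esub> x = \<zero>\<^bsub>T\<^esub>" if x: "x \<in> carrier T" for x
    proof -
      obtain y where y: "y \<in> carrier T" "h y = \<ominus>\<^bsub>L\<^esub> h x"
        using bij hc[OF x] by (metis L.M.a_inv_closed bij_betw_def imageE)
      have "y \<oplus>\<^bsub>T\<^esub> x = \<zero>\<^bsub>T\<^esub>"
        by (rule inj) (use x y add zero hc in \<open>auto simp: L.M.l_neg\<close>)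
      with y show ?thesis by blast
    qed
  qed (auto intro!: inj L.R.ring_axioms
      simp: add smult zero hc L.M.add.m_ac L.smult_l_distr L.smult_r_distr L.smult_assoc1)
qed

theorem direct_power_projective_lift:
  fixes M :: "('r, 'm, 'y) module_scheme" and \<Lambda> :: "'i set" and L' :: "('r, 'n, 'z) module_scheme"
  assumes "left_module R M" and proj: "direct_power_projective R M"
    and L': "left_module R L'"
    and \<rho>: "\<rho> \<in> lmod_epi R (direct_power M \<Lambda>) L'" and \<alpha>: "\<alpha> \<in> lmod_hom R M L'"
  shows "\<exists>\<beta> \<in> lmod_hom R M (direct_power M \<Lambda>). \<forall>x\<in>carrier M. \<rho> (\<beta> x) = \<alpha> x"
proof -
  interpret M: left_module R M by fact
  interpret L': left_module R L' by fact
  let ?P = "direct_power M \<Lambda>"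
  interpret P: left_module R ?P by (rule M.left_module_direct_power)
  define supp where "supp z = {i \<in> \<Lambda>. z i \<noteq> \<zero>\<^bsub>M\<^esub>}" for z
  have "\<forall>x\<in>carrier M. \<exists>z\<in>carrier ?P. \<rho> z = \<alpha> x"
    using \<rho> \<alpha> unfolding lmod_epi_def lmod_hom_def by (smt (verit) PiE imageE mem_Collect_eq)
  then obtain g where g: "\<And>x. x \<in> carrier M \<Longrightarrow> g x \<in> carrier ?P"
      "\<And>x. x \<in> carrier M \<Longrightarrow> \<rho> (g x) = \<alpha> x"
    by metis
  have fin: "finite (supp (g x))" if "x \<in> carrier M" for x
    using g(1)[OF that] by (simp add: direct_power_def supp_def)
  define \<Lambda>0 where "\<Lambda>0 = (\<Union>x\<in>carrier M. supp (g x))"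
  have "\<forall>i\<in>\<Lambda>0. \<exists>x. x \<in> carrier M \<and> i \<in> supp (g x)"
    by (auto simp: \<Lambda>0_def)
  then obtain p where p: "\<And>i. i \<in> \<Lambda>0 \<Longrightarrow> p i \<in> carrier M \<and> i \<in> supp (g (p i))"
    by metis
  define e where "e i = (p i, to_nat_on (supp (g (p i))) i)" for i
  have e: "inj_on e \<Lambda>0"
  proof (rule inj_onI)
    fix i j assume ij: "i \<in> \<Lambda>0" "j \<in> \<Lambda>0" "e i = e j"
    then have "p i = p j" by (simp add: e_def)
    with ij p[of i] p[of j] show "i = j"
      by (simp add: e_def countable_finite[OF fin])
  qed
  define \<Lambda>1 where "\<Lambda>1 = e ` \<Lambda>0"
  let ?Q = "direct_power M \<Lambda>1"
  interpret Q: left_module R ?Q by (rule M.left_module_direct_power)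
  have sub: "\<Lambda>0 \<subseteq> \<Lambda>" by (auto simp: \<Lambda>0_def supp_def)
  define E where "E w = (\<lambda>i\<in>\<Lambda>. if i \<in> \<Lambda>0 then w (e i) else \<zero>\<^bsub>M\<^esub>)" for w
  have E: "E \<in> lmod_hom R ?Q ?P"
  proof -
    have "E w \<in> carrier ?P" if w: "w \<in> carrier ?Q" for w
    proof -
      have "e ` {i \<in> \<Lambda>. E w i \<noteq> \<zero>\<^bsub>M\<^esub>} \<subseteq> {j \<in> \<Lambda>1. w j \<noteq> \<zero>\<^bsub>M\<^esub>}"
        by (auto simp: E_def \<Lambda>1_def split: if_splits)
      moreover have "finite {j \<in> \<Lambda>1. w j \<noteq> \<zero>\<^bsub>M\<^esub>}"
        using w by (simp add: direct_power_def)
      moreover have "inj_on e {i \<in> \<Lambda>. E w i \<noteq> \<zero>\<^bsub>M\<^esub>}"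
        by (rule inj_on_subset[OF e]) (auto simp: E_def split: if_splits)
      ultimately have "finite {i \<in> \<Lambda>. E w i \<noteq> \<zero>\<^bsub>M\<^esub>}"
        by (meson finite_imageD finite_subset)
      then show ?thesis
        using w by (auto simp: direct_power_def E_def PiE_iff \<Lambda>1_def)
    qed
    then show ?thesis
      by (auto simp: lmod_hom_def)
         (auto simp: direct_power_def E_def fun_eq_iff \<Lambda>1_def M.smult_zero_right)
  qed
  have gE: "\<exists>w\<in>carrier ?Q. E w = g x" if x: "x \<in> carrier M" for x
  proof
    let ?w = "\<lambda>j\<in>\<Lambda>1. g x (the_inv_into \<Lambda>0 e j)"
    have inv: "the_inv_into \<Lambda>0 e (e i) = i" if "i \<in> \<Lambda>0" for i
      using the_inv_into_f_f[OF e that] .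
    have "{j \<in> \<Lambda>1. ?w j \<noteq> \<zero>\<^bsub>M\<^esub>} \<subseteq> e ` supp (g x)"
      using sub by (auto simp: \<Lambda>1_def inv supp_def)
    then have "finite {j \<in> \<Lambda>1. ?w j \<noteq> \<zero>\<^bsub>M\<^esub>}"
      using fin[OF x] by (meson finite_imageI finite_subset)
    then show "?w \<in> carrier ?Q"
      using g(1)[OF x] sub by (auto simp: direct_power_def PiE_iff \<Lambda>1_def inv)
    show "E ?w = g x"
    proof
      fix i
      have "g x i = \<zero>\<^bsub>M\<^esub>" if "i \<in> \<Lambda>" "i \<notin> \<Lambda>0"
        using that x by (auto simp: \<Lambda>0_def supp_def)
      moreover have "g x i = undefined" if "i \<notin> \<Lambda>"
        using g(1)[OF x] that by (auto simp: direct_power_def PiE_iff extensional_def)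
      ultimately show "E ?w i = g x i"
        by (auto simp: E_def \<Lambda>1_def inv)
    qed
  qed
  define \<rho>1 where "\<rho>1 = \<rho> \<circ> E"
  have \<rho>1: "\<rho>1 \<in> lmod_hom R ?Q L'"
    using E \<rho> by (auto simp: \<rho>1_def lmod_hom_def lmod_epi_def Pi_iff)
  define I where "I = \<rho>1 ` carrier ?Q"
  have \<rho>1_add: "\<rho>1 (v \<oplus>\<^bsub>?Q\<^esub> w) = \<rho>1 v \<oplus>\<^bsub>L'\<^esub> \<rho>1 w" if "v \<in> carrier ?Q" "w \<in> carrier ?Q" for v w
    using \<rho>1 that by (auto simp: lmod_hom_def)
  have \<rho>1_smult: "\<rho>1 (a \<odot>\<^bsub>?Q\<^esub> v) = a \<odot>\<^bsub>L'\<^esub> \<rho>1 v" if "a \<in> carrier R" "v \<in> carrier ?Q" for a v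
    using \<rho>1 that by (auto simp: lmod_hom_def)
  have I_sub: "I \<subseteq> carrier L'"
    using \<rho>1 by (auto simp: I_def lmod_hom_def)
  have I_add: "x \<oplus>\<^bsub>L'\<^esub> y \<in> I" if "x \<in> I" "y \<in> I" for x y
  proof -
    from that obtain v w where "v \<in> carrier ?Q" "w \<in> carrier ?Q" "x = \<rho>1 v" "y = \<rho>1 w"
      by (auto simp: I_def)
    then show ?thesis using \<rho>1_add by (metis I_def Q.M.add.m_closed imageI)
  qed
  have I_smult: "a \<odot>\<^bsub>L'\<^esub> x \<in> I" if "a \<in> carrier R" "x \<in> I" for a x
  proof -
    from that obtain v where "v \<in> carrier ?Q" "x = \<rho>1 v"
      by (auto simp: I_def)
    then show ?thesis using \<rho>1_smult that by (metis I_def Q.smult_closed imageI)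
  qed
  have I_zero: "\<zero>\<^bsub>L'\<^esub> \<in> I"
  proof -
    have "\<rho>1 \<zero>\<^bsub>?Q\<^esub> \<in> I" by (simp add: I_def)
    then have "\<zero>\<^bsub>R\<^esub> \<odot>\<^bsub>L'\<^esub> \<rho>1 \<zero>\<^bsub>?Q\<^esub> \<in> I" by (intro I_smult) auto
    then show ?thesis using I_sub \<open>\<rho>1 \<zero>\<^bsub>?Q\<^esub> \<in> I\<close> by (metis L'.smult_zero_left subsetD)
  qed
  have "left_module R (L'\<lparr>carrier := I\<rparr>)"
  proof (intro left_moduleI abelian_groupI)
    show "\<exists>y\<in>carrier (L'\<lparr>carrier := I\<rparr>). y \<oplus>\<^bsub>L'\<lparr>carrier := I\<rparr>\<^esub> x = \<zero>\<^bsub>L'\<lparr>carrier := I\<rparr>\<^esub>"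
      if "x \<in> carrier (L'\<lparr>carrier := I\<rparr>)" for x
    proof (rule bexI[of _ "(\<ominus>\<^bsub>R\<^esub> \<one>\<^bsub>R\<^esub>) \<odot>\<^bsub>L'\<^esub> x"])
      have x: "x \<in> carrier L'" "x \<in> I" using that I_sub by auto
      show "(\<ominus>\<^bsub>R\<^esub> \<one>\<^bsub>R\<^esub>) \<odot>\<^bsub>L'\<^esub> x \<oplus>\<^bsub>L'\<lparr>carrier := I\<rparr>\<^esub> x = \<zero>\<^bsub>L'\<lparr>carrier := I\<rparr>\<^esub>"
        using L'.smult_l_distr[of "\<ominus>\<^bsub>R\<^esub> \<one>\<^bsub>R\<^esub>" "\<one>\<^bsub>R\<^esub>" x] x
        by (simp add: M.R.l_neg L'.smult_zero_left)
      show "(\<ominus>\<^bsub>R\<^esub> \<one>\<^bsub>R\<^esub>) \<odot>\<^bsub>L'\<^esub> x \<in> carrier (L'\<lparr>carrier := I\<rparr>)"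
        using x I_smult by simp
    qed
  qed (use I_sub in \<open>auto simp: I_add I_smult I_zero L'.M.add.m_ac L'.smult_l_distr
        L'.smult_r_distr L'.smult_assoc1 subset_iff intro!: M.R.ring_axioms\<close>)
  note I_module = this
  define F where "F y = {w \<in> carrier ?Q. \<rho>1 w = y}" for y
  define G where "G A = \<rho>1 (SOME w. w \<in> A)" for A
  have GF: "G (F y) = y" if "y \<in> I" for y
  proof -
    have "\<exists>w. w \<in> F y" using that by (auto simp: I_def F_def)
    then have "(SOME w. w \<in> F y) \<in> F y" by (rule someI_ex)
    then show ?thesis by (simp add: F_def G_def)
  qed
  define T :: "('r, ('m \<times> nat \<Rightarrow> 'm) set) module" where
    "T = \<lparr>carrier = F ` I, mult = undefined, one = undefined, zero = F \<zero>\<^bsub>L'\<^esub>,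
      add = (\<lambda>A B. F (G A \<oplus>\<^bsub>L'\<^esub> G B)), smult = (\<lambda>a A. F (a \<odot>\<^bsub>L'\<^esub> G A))\<rparr>"
  have T: "left_module R T"
  proof (rule left_module_transport[OF I_module])
    show "bij_betw G (carrier T) (carrier (L'\<lparr>carrier := I\<rparr>))"
      by (rule bij_betw_byWitness[where f' = F]) (auto simp: T_def GF)
  qed (auto simp: T_def GF I_add I_smult I_zero)
  have "(F \<circ> \<rho>1) \<in> lmod_epi R ?Q T"
  proof -
    have "\<rho>1 w \<in> I" if "w \<in> carrier ?Q" for w using that by (simp add: I_def)
    then show ?thesis
      by (auto simp: lmod_epi_def lmod_hom_def T_def GF \<rho>1_add \<rho>1_smult)
         (auto simp: I_def)
  qed
  moreover have \<alpha>I: "\<alpha> x \<in> I" if "x \<in> carrier M" for x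
    using gE[OF that] g(2)[OF that] by (force simp: I_def \<rho>1_def)
  then have "(F \<circ> \<alpha>) \<in> lmod_hom R M T"
    using \<alpha> by (auto simp: lmod_hom_def T_def GF)
  moreover have "rel_projective R M ?Q"
    using proj by (simp add: direct_power_projective_def)
  ultimately have "\<exists>\<beta>1 \<in> lmod_hom R M ?Q. \<forall>x\<in>carrier M. (F \<circ> \<rho>1) (\<beta>1 x) = (F \<circ> \<alpha>) x"
    using T unfolding rel_projective_def by blast
  then obtain \<beta>1 where \<beta>1: "\<beta>1 \<in> lmod_hom R M ?Q"
      "\<And>x. x \<in> carrier M \<Longrightarrow> F (\<rho>1 (\<beta>1 x)) = F (\<alpha> x)"
    by auto
  have "E \<circ> \<beta>1 \<in> lmod_hom R M ?P"
    using E \<beta>1(1) by (auto simp: lmod_hom_def Pi_iff)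
  moreover have "\<rho> ((E \<circ> \<beta>1) x) = \<alpha> x" if x: "x \<in> carrier M" for x
  proof -
    have "\<rho>1 (\<beta>1 x) \<in> I" using \<beta>1(1) x by (auto simp: lmod_hom_def I_def)
    then have "\<rho>1 (\<beta>1 x) = \<alpha> x" using \<beta>1(2)[OF x] GF \<alpha>I[OF x] by metis
    then show ?thesis by (simp add: \<rho>1_def)
  qed
  ultimately show ?thesis by blast
qed

end

theory Submission
  imports Defs
begin

text \<open>Let \<open>N\<close> be the prime radical.  Projectivity relative to the powers of \<open>M\<close> splits the
  epimorphism from the direct sum of all cyclic submodules of \<open>M\<close> onto \<open>M\<close>, so the identity of \<open>M\<close>
  is a locally finite sum of endomorphisms with cyclic image.  Hence an endomorphism into \<open>N\<close> is a
  locally finite sum of elements of the set \<open>C\<close> of endomorphisms whose image lies in some \<open>R z\<close> with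
  \<open>z \<in> N\<close>.  An element \<open>h\<close> of \<open>C\<close> is locally nilpotent: otherwise the elements \<open>h\<^sup>k z\<close> with
  \<open>k = 2\<^sup>n - 1\<close> would form an m-sequence avoiding \<open>0\<close>, and Zorn's lemma would yield a prime submodule
  that does not contain \<open>z\<close>.  Lanski's theorem that nil subrings of Goldie rings are nilpotent can
  be carried out directly for the multiplicatively closed set \<open>C\<close> acting on \<open>M\<close>, and shows that
  all products of \<open>p\<close> elements of \<open>C\<close> vanish for some \<open>p\<close>.\<close>

section \<open>Homomorphisms and submodules\<close>

text \<open>The obstacle is that \<open>M\<close> need not be finitely generated. An endomorphism
  into \<open>N\<close> is then only a locally finite sum of maps with cyclic image, so nilpotency
  of the summands does not carry over to it directly. The proof therefore stays with
  \<open>C\<close>, which is stable under composition with endomorphisms on either side but not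
  visibly under addition, and with nilpotency whose exponent depends on the point. Sums reappear
  only at the end, where submodules, the iterated annihilators of \<open>C\<close>, absorb them
  pointwise. Cyclic images tie endomorphisms to single elements: if \<open>h\<close> maps
  \<open>M\<close> into \<open>R z\<close>, then a submodule containing \<open>h^k z\<close>
  contains the whole image of \<open>h^(k+1)\<close>, so one element controls a map that can enter a
  product of submodules.\<close>

lemma lmod_homI:
  assumes "\<And>x. x \<in> carrier M \<Longrightarrow> f x \<in> carrier N"
    and "\<And>x y. \<lbrakk>x \<in> carrier M; y \<in> carrier M\<rbrakk> \<Longrightarrow> f (x \<oplus>\<^bsub>M\<^esub> y) = f x \<oplus>\<^bsub>N\<^esub> f y"
    and "\<And>a x. \<lbrakk>a \<in> carrier R; x \<in> carrier M\<rbrakk> \<Longrightarrow> f (a \<odot>\<^bsub>M\<^esub> x) = a \<odot>\<^bsub>N\<^esub> f x"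
  shows "f \<in> lmod_hom R M N"
  using assms by (auto simp: lmod_hom_def)

lemma lmod_homD:
  assumes "f \<in> lmod_hom R M N"
  shows "x \<in> carrier M \<Longrightarrow> f x \<in> carrier N"
    and "\<lbrakk>x \<in> carrier M; y \<in> carrier M\<rbrakk> \<Longrightarrow> f (x \<oplus>\<^bsub>M\<^esub> y) = f x \<oplus>\<^bsub>N\<^esub> f y"
    and "\<lbrakk>a \<in> carrier R; x \<in> carrier M\<rbrakk> \<Longrightarrow> f (a \<odot>\<^bsub>M\<^esub> x) = a \<odot>\<^bsub>N\<^esub> f x"
  using assms by (auto simp: lmod_hom_def)

lemma lmod_hom_comp:
  assumes "f \<in> lmod_hom R M N" "g \<in> lmod_hom R L M"
  shows "f \<circ> g \<in> lmod_hom R L N"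
  using assms by (auto simp: lmod_hom_def Pi_iff)

lemma id_in_lmod_end: "id \<in> lmod_end R M"
  by (auto simp: lmod_hom_def)

lemma lmod_hom_carrier_update:
  assumes "B \<subseteq> carrier N"
  shows "lmod_hom R M (N\<lparr>carrier := B\<rparr>) = {f \<in> lmod_hom R M N. f ` carrier M \<subseteq> B}"
  using assms by (auto simp: lmod_hom_def)

lemma lmod_hom_zero:
  assumes "left_module R M" "left_module R N" "f \<in> lmod_hom R M N"
  shows "f \<zero>\<^bsub>M\<^esub> = \<zero>\<^bsub>N\<^esub>"
proof -
  interpret M: left_module R M by fact
  interpret N: left_module R N by fact
  have "f (\<zero>\<^bsub>R\<^esub> \<odot>\<^bsub>M\<^esub> \<zero>\<^bsub>M\<^esub>) = \<zero>\<^bsub>R\<^esub> \<odot>\<^bsub>N\<^esub> f \<zero>\<^bsub>M\<^esub>"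
    using lmod_homD[OF assms(3)] by simp
  then show ?thesis
    using lmod_homD(1)[OF assms(3)] by (simp add: M.smult_zero_left N.smult_zero_left)
qed

context left_module
begin

lemma smult_minus_one:
  assumes "x \<in> carrier M"
  shows "(\<ominus>\<one>) \<odot>\<^bsub>M\<^esub> x = \<ominus>\<^bsub>M\<^esub> x"
proof -
  have "(\<ominus>\<one>) \<odot>\<^bsub>M\<^esub> x \<oplus>\<^bsub>M\<^esub> x = \<zero>\<^bsub>M\<^esub>"
    using smult_l_distr[of "\<ominus>\<one>" \<one> x] assms by (simp add: R.l_neg smult_zero_left)
  then show ?thesis
    using assms by (intro M.minus_equality[symmetric]) auto
qed

lemma submodule_iff:
  "submodule H R M \<longleftrightarrow> H \<subseteq> carrier M \<and> \<zero>\<^bsub>M\<^esub> \<in> H \<and>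
    (\<forall>x\<in>H. \<forall>y\<in>H. x \<oplus>\<^bsub>M\<^esub> y \<in> H) \<and> (\<forall>a\<in>carrier R. \<forall>x\<in>H. a \<odot>\<^bsub>M\<^esub> x \<in> H)"
    (is "_ \<longleftrightarrow> ?rhs")
proof
  assume "submodule H R M"
  then interpret H: submodule H R M .
  show ?rhs using H.subset H.one_closed H.m_closed by auto
next
  assume H: ?rhs
  \<comment> \<open>Negatives come from the scalar -1, so closure under scalars supplies
    them.\<close>
  have "inv\<^bsub>add_monoid M\<^esub> x \<in> H" if "x \<in> H" for x
  proof -
    have "(\<ominus>\<one>) \<odot>\<^bsub>M\<^esub> x \<in> H" "x \<in> carrier M" using H that by auto
    then show ?thesis by (simp add: smult_minus_one flip: a_inv_def)
  qed
  with H show "submodule H R M"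
    by (intro submodule.intro subgroup.intro submodule_axioms.intro) simp_all
qed

lemma submoduleI:
  assumes "H \<subseteq> carrier M" "\<zero>\<^bsub>M\<^esub> \<in> H"
    and "\<And>x y. \<lbrakk>x \<in> H; y \<in> H\<rbrakk> \<Longrightarrow> x \<oplus>\<^bsub>M\<^esub> y \<in> H"
    and "\<And>a x. \<lbrakk>a \<in> carrier R; x \<in> H\<rbrakk> \<Longrightarrow> a \<odot>\<^bsub>M\<^esub> x \<in> H"
  shows "submodule H R M"
  using assms by (simp add: submodule_iff)

lemma submoduleD:
  assumes "submodule H R M"
  shows "H \<subseteq> carrier M" "x \<in> H \<Longrightarrow> x \<in> carrier M" "\<zero>\<^bsub>M\<^esub> \<in> H"
    and "\<lbrakk>x \<in> H; y \<in> H\<rbrakk> \<Longrightarrow> x \<oplus>\<^bsub>M\<^esub> y \<in> H"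
    and "\<lbrakk>a \<in> carrier R; x \<in> H\<rbrakk> \<Longrightarrow> a \<odot>\<^bsub>M\<^esub> x \<in> H"
    and "x \<in> H \<Longrightarrow> \<ominus>\<^bsub>M\<^esub> x \<in> H"
proof -
  have H: "H \<subseteq> carrier M" "\<And>a x. a \<in> carrier R \<Longrightarrow> x \<in> H \<Longrightarrow> a \<odot>\<^bsub>M\<^esub> x \<in> H"
    using assms unfolding submodule_iff by blast+
  show "\<ominus>\<^bsub>M\<^esub> x \<in> H" if "x \<in> H"
    using H(2)[of "\<ominus>\<one>" x] H(1) that smult_minus_one[of x] by auto
qed (use assms in \<open>unfold submodule_iff, blast+\<close>)

lemma submodule_zero: "submodule {\<zero>\<^bsub>M\<^esub>} R M"
  by (rule submoduleI) (auto simp: smult_zero_right)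

lemma submodule_carrier: "submodule (carrier M) R M"
  by (rule submoduleI) auto

lemma submodule_Int:
  assumes "submodule A R M" "submodule B R M"
  shows "submodule (A \<inter> B) R M"
  using assms by (auto simp: submodule_iff)

lemma submodule_cyclic:
  assumes "z \<in> carrier M"
  shows "submodule ((\<lambda>a. a \<odot>\<^bsub>M\<^esub> z) ` carrier R) R M"
proof (rule submoduleI)
  show "\<zero>\<^bsub>M\<^esub> \<in> (\<lambda>a. a \<odot>\<^bsub>M\<^esub> z) ` carrier R"
    using smult_zero_left[OF assms] by (metis R.zero_closed imageI)
qed (use assms in \<open>auto simp: smult_l_distr[symmetric] smult_assoc1[symmetric]\<close>)

lemma lmod_end_zero:
  assumes "f \<in> lmod_end R M"
  shows "f \<zero>\<^bsub>M\<^esub> = \<zero>\<^bsub>M\<^esub>"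
  using lmod_hom_zero[OF _ _ assms] left_module_axioms by blast

lemma submodule_preimage:
  assumes "f \<in> lmod_end R M" "submodule H R M"
  shows "submodule {x \<in> carrier M. f x \<in> H} R M"
  using assms lmod_end_zero[OF assms(1)]
  by (intro submoduleI) (auto simp: submodule_iff lmod_homD)

lemma submodule_image:
  assumes f: "f \<in> lmod_end R M"
  shows "submodule (f ` carrier M) R M"
proof (rule submoduleI)
  show "\<zero>\<^bsub>M\<^esub> \<in> f ` carrier M"
    using lmod_end_zero[OF f] by (intro image_eqI[of _ _ "\<zero>\<^bsub>M\<^esub>"]) auto
qed (auto simp: lmod_homD(1)[OF f] lmod_homD(2,3)[OF f, symmetric])

lemma submodule_set_add:
  assumes A: "submodule A R M" and B: "submodule B R M"
  defines "S \<equiv> {a \<oplus>\<^bsub>M\<^esub> b | a b. a \<in> A \<and> b \<in> B}"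
  shows "submodule S R M" "A \<subseteq> S" "B \<subseteq> S"
proof -
  have S: "a \<oplus>\<^bsub>M\<^esub> b \<in> S" if "a \<in> A" "b \<in> B" for a b
    using that by (auto simp: S_def)
  note cA = submoduleD(2)[OF A] and cB = submoduleD(2)[OF B]
  show "A \<subseteq> S"
    using S[OF _ submoduleD(3)[OF B]] cA by auto
  show "B \<subseteq> S"
    using S[OF submoduleD(3)[OF A]] cB by auto
  show "submodule S R M"
  proof (rule submoduleI)
    show "S \<subseteq> carrier M" using cA cB by (auto simp: S_def)
    show "\<zero>\<^bsub>M\<^esub> \<in> S" using \<open>A \<subseteq> S\<close> submoduleD(3)[OF A] by blast
    show "x \<oplus>\<^bsub>M\<^esub> y \<in> S" if xy: "x \<in> S" "y \<in> S" for x y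
    proof -
      from xy obtain a b c d where *: "a \<in> A" "b \<in> B" "c \<in> A" "d \<in> B"
        "x = a \<oplus>\<^bsub>M\<^esub> b" "y = c \<oplus>\<^bsub>M\<^esub> d" unfolding S_def by blast
      then have "x \<oplus>\<^bsub>M\<^esub> y = (a \<oplus>\<^bsub>M\<^esub> c) \<oplus>\<^bsub>M\<^esub> (b \<oplus>\<^bsub>M\<^esub> d)"
        using cA[of a] cA[of c] cB[of b] cB[of d] by (simp add: M.add.m_ac)
      then show ?thesis using * S submoduleD(4)[OF A] submoduleD(4)[OF B] by simp
    qed
    show "r \<odot>\<^bsub>M\<^esub> x \<in> S" if r: "r \<in> carrier R" and x: "x \<in> S" for r x
    proof -
      from x obtain a b where *: "a \<in> A" "b \<in> B" "x = a \<oplus>\<^bsub>M\<^esub> b" unfolding S_def by blast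
      then have "r \<odot>\<^bsub>M\<^esub> x = r \<odot>\<^bsub>M\<^esub> a \<oplus>\<^bsub>M\<^esub> r \<odot>\<^bsub>M\<^esub> b"
        using r cA[of a] cB[of b] by (simp add: smult_r_distr)
      then show ?thesis using r * S submoduleD(5)[OF A] submoduleD(5)[OF B] by simp
    qed
  qed
qed

section \<open>Finite sums and sums of submodules\<close>

lemma finsum_in_submodule:
  assumes "submodule H R M" "finite F" "\<And>i. i \<in> F \<Longrightarrow> x i \<in> H"
  shows "(\<Oplus>\<^bsub>M\<^esub>i\<in>F. x i) \<in> H"
  using assms(2,3)
proof (induction F rule: finite_induct)
  case empty
  then show ?case using submoduleD(3)[OF assms(1)] by simp
next
  case (insert i F)
  moreover have "x \<in> insert i F \<rightarrow> carrier M" using insert submoduleD(2)[OF assms(1)] by blast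
  ultimately show ?case
    using submoduleD(4)[OF assms(1)] by (subst M.finsum_insert) auto
qed

lemma finsum_smult:
  assumes "finite F" "a \<in> carrier R" "x \<in> F \<rightarrow> carrier M"
  shows "(\<Oplus>\<^bsub>M\<^esub>i\<in>F. a \<odot>\<^bsub>M\<^esub> x i) = a \<odot>\<^bsub>M\<^esub> (\<Oplus>\<^bsub>M\<^esub>i\<in>F. x i)"
  using assms
proof (induction F rule: finite_induct)
  case (insert i F)
  then show ?case
    by (subst (1 2) M.finsum_insert) (auto simp: Pi_iff smult_r_distr)
qed (simp add: smult_zero_right)

text \<open>Padding by zero brings two sums over different finite index sets to a common one, as
  closure of \<open>submodule_sum\<close> under addition requires.\<close>

lemma finsum_extend_zero:
  assumes "finite G" "F \<subseteq> G" "x \<in> F \<rightarrow> carrier M"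
  shows "(\<Oplus>\<^bsub>M\<^esub>i\<in>G. if i \<in> F then x i else \<zero>\<^bsub>M\<^esub>) = (\<Oplus>\<^bsub>M\<^esub>i\<in>F. x i)"
  by (rule M.add.finprod_mono_neutral_cong_left[symmetric]) (use assms in auto)

lemma submodule_sum_subset:
  assumes "submodule H R M" "\<And>i. i \<in> I \<Longrightarrow> A i \<subseteq> H"
  shows "submodule_sum M I A \<subseteq> H"
  using finsum_in_submodule[OF assms(1)] assms(2) unfolding submodule_sum_def by blast

lemma submodule_sum_upper:
  assumes "i \<in> I" "A i \<subseteq> carrier M"
  shows "A i \<subseteq> submodule_sum M I A"
proof
  fix x assume x: "x \<in> A i"
  have "(\<Oplus>\<^bsub>M\<^esub>j\<in>{i}. x) = x"
    using x assms by (subst M.finsum_insert) auto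
  then show "x \<in> submodule_sum M I A"
    using x assms unfolding submodule_sum_def
    by (intro CollectI exI[of _ "{i}"] exI[of _ "\<lambda>_. x"]) auto
qed

lemma submodule_submodule_sum:
  assumes "\<And>i. i \<in> I \<Longrightarrow> submodule (A i) R M"
  shows "submodule (submodule_sum M I A) R M"
proof (rule submoduleI)
  note D = submoduleD[OF assms]
  show "submodule_sum M I A \<subseteq> carrier M"
    by (rule submodule_sum_subset[OF submodule_carrier D(1)])
  have "\<exists>F x. \<zero>\<^bsub>M\<^esub> = (\<Oplus>\<^bsub>M\<^esub>i\<in>F. x i) \<and> finite F \<and> F \<subseteq> I \<and> (\<forall>i\<in>F. x i \<in> A i)"
    by (rule exI[of _ "{}"]) simp
  then show "\<zero>\<^bsub>M\<^esub> \<in> submodule_sum M I A"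
    unfolding submodule_sum_def by blast
  show "u \<oplus>\<^bsub>M\<^esub> v \<in> submodule_sum M I A"
    if uv: "u \<in> submodule_sum M I A" "v \<in> submodule_sum M I A" for u v
  proof -
    from uv obtain F G x y where F: "finite F" "F \<subseteq> I" "\<forall>i\<in>F. x i \<in> A i" "u = (\<Oplus>\<^bsub>M\<^esub>i\<in>F. x i)"
      and G: "finite G" "G \<subseteq> I" "\<forall>i\<in>G. y i \<in> A i" "v = (\<Oplus>\<^bsub>M\<^esub>i\<in>G. y i)"
      unfolding submodule_sum_def by blast
    define x' where "x' i = (if i \<in> F then x i else \<zero>\<^bsub>M\<^esub>)" for i
    define y' where "y' i = (if i \<in> G then y i else \<zero>\<^bsub>M\<^esub>)" for i
    have x': "x' i \<in> A i" "x' i \<in> carrier M" and y': "y' i \<in> A i" "y' i \<in> carrier M"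
      if "i \<in> F \<union> G" for i
      using that F G D(2,3) by (auto simp: x'_def y'_def)
    have "u = (\<Oplus>\<^bsub>M\<^esub>i\<in>F \<union> G. x' i)" "v = (\<Oplus>\<^bsub>M\<^esub>i\<in>F \<union> G. y' i)"
      unfolding x'_def y'_def F G
      by (rule finsum_extend_zero[symmetric]; use F G D in blast)+
    then have "u \<oplus>\<^bsub>M\<^esub> v = (\<Oplus>\<^bsub>M\<^esub>i\<in>F \<union> G. x' i \<oplus>\<^bsub>M\<^esub> y' i)"
      using x' y' by (simp add: M.finsum_addf Pi_iff)
    moreover have "finite (F \<union> G)" "F \<union> G \<subseteq> I" using F G by auto
    moreover have "\<forall>i\<in>F \<union> G. x' i \<oplus>\<^bsub>M\<^esub> y' i \<in> A i"
      using x'(1) y'(1) D(4) \<open>F \<union> G \<subseteq> I\<close> by blast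
    ultimately show ?thesis
      unfolding submodule_sum_def
      by (intro CollectI exI[of _ "F \<union> G"] exI[of _ "\<lambda>i. x' i \<oplus>\<^bsub>M\<^esub> y' i"]) simp
  qed
  show "a \<odot>\<^bsub>M\<^esub> u \<in> submodule_sum M I A"
    if a: "a \<in> carrier R" and u: "u \<in> submodule_sum M I A" for a u
  proof -
    from u obtain F x where F: "finite F" "F \<subseteq> I" "\<forall>i\<in>F. x i \<in> A i" "u = (\<Oplus>\<^bsub>M\<^esub>i\<in>F. x i)"
      unfolding submodule_sum_def by blast
    then have "a \<odot>\<^bsub>M\<^esub> u = (\<Oplus>\<^bsub>M\<^esub>i\<in>F. a \<odot>\<^bsub>M\<^esub> x i)"
      using a D(2) by (subst finsum_smult) auto
    with F a D(5) show ?thesis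
      unfolding submodule_sum_def
      by (intro CollectI exI[of _ F] exI[of _ "\<lambda>i. a \<odot>\<^bsub>M\<^esub> x i"]) auto
  qed
qed

end

section \<open>Lifting and the dual basis\<close>

text \<open>The quotient lives on cosets because \<open>rel_projective\<close> tests codomains of
  type \<open>'l set\<close>. Besides being an epimorphism, \<open>\<pi>\<close> is known later only
  through its fibres.\<close>

lemma quotient_module_exists:
  fixes R :: "('r, 'x) ring_scheme" and L :: "('r, 'l, 'z) module_scheme"
  assumes "left_module R L" and X: "submodule X R L"
  obtains Q :: "('r, 'l set) module" and \<pi>
  where "left_module R Q" "\<pi> \<in> lmod_epi R L Q"
    and "\<And>z w. \<lbrakk>z \<in> carrier L; w \<in> carrier L\<rbrakk> \<Longrightarrow> \<pi> z = \<pi> w \<longleftrightarrow> (\<exists>k\<in>X. w = z \<oplus>\<^bsub>L\<^esub> k)"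
proof -
  interpret L: left_module R L by fact
  note Xc = L.submoduleD(2)[OF X] and X0 = L.submoduleD(3)[OF X]
    and Xa = L.submoduleD(4)[OF X] and Xs = L.submoduleD(5)[OF X] and Xm = L.submoduleD(6)[OF X]
  define \<pi> where "\<pi> z = {z \<oplus>\<^bsub>L\<^esub> k | k. k \<in> X}" for z
  have \<pi>_shift: "\<pi> (z \<oplus>\<^bsub>L\<^esub> k) = \<pi> z" if z: "z \<in> carrier L" and k: "k \<in> X" for z k
  proof
    show "\<pi> (z \<oplus>\<^bsub>L\<^esub> k) \<subseteq> \<pi> z"
      using z k Xc Xa by (force simp: \<pi>_def L.M.a_assoc)
    show "\<pi> z \<subseteq> \<pi> (z \<oplus>\<^bsub>L\<^esub> k)"
    proof
      fix w assume "w \<in> \<pi> z"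
      then obtain l where l: "l \<in> X" "w = z \<oplus>\<^bsub>L\<^esub> l" by (auto simp: \<pi>_def)
      have "k \<oplus>\<^bsub>L\<^esub> (\<ominus>\<^bsub>L\<^esub> k \<oplus>\<^bsub>L\<^esub> l) = l"
        using Xc[OF k] Xc[OF l(1)] by (simp add: L.M.a_assoc[symmetric] L.M.r_neg)
      then have "w = z \<oplus>\<^bsub>L\<^esub> k \<oplus>\<^bsub>L\<^esub> (\<ominus>\<^bsub>L\<^esub> k \<oplus>\<^bsub>L\<^esub> l)"
        using z Xc[OF k] Xc[OF l(1)] l(2) by (simp add: L.M.a_assoc)
      then show "w \<in> \<pi> (z \<oplus>\<^bsub>L\<^esub> k)"
        using Xa[OF Xm[OF k] l(1)] by (auto simp: \<pi>_def)
    qed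
  qed
  have \<pi>_eq: "\<pi> z = \<pi> w \<longleftrightarrow> (\<exists>k\<in>X. w = z \<oplus>\<^bsub>L\<^esub> k)" if "z \<in> carrier L" "w \<in> carrier L" for z w
  proof
    assume "\<pi> z = \<pi> w"
    moreover have "w \<in> \<pi> w"
      using that X0 by (auto simp: \<pi>_def intro!: exI[of _ "\<zero>\<^bsub>L\<^esub>"])
    ultimately show "\<exists>k\<in>X. w = z \<oplus>\<^bsub>L\<^esub> k" by (auto simp: \<pi>_def)
  qed (use that \<pi>_shift in auto)
  \<comment> \<open>Operations on cosets go through chosen representatives; another choice changes
    the result by an element of \<open>X\<close>, which \<open>\<pi>_shift\<close> absorbs.\<close>
  define rep where "rep A = (SOME z. z \<in> carrier L \<and> \<pi> z = A)" for A
  have rep: "rep (\<pi> z) \<in> carrier L \<and> (\<exists>k\<in>X. rep (\<pi> z) = z \<oplus>\<^bsub>L\<^esub> k)" if z: "z \<in> carrier L" for z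
  proof -
    have "rep (\<pi> z) \<in> carrier L \<and> \<pi> (rep (\<pi> z)) = \<pi> z"
      unfolding rep_def by (rule someI_ex) (use z in auto)
    then show ?thesis using \<pi>_eq[of z "rep (\<pi> z)"] z by simp
  qed
  define Q :: "('r, 'l set) module" where
    "Q = \<lparr>carrier = \<pi> ` carrier L, mult = undefined, one = undefined, zero = \<pi> \<zero>\<^bsub>L\<^esub>,
      add = (\<lambda>A B. \<pi> (rep A \<oplus>\<^bsub>L\<^esub> rep B)), smult = (\<lambda>a A. \<pi> (a \<odot>\<^bsub>L\<^esub> rep A))\<rparr>"
  have Q_add: "\<pi> z \<oplus>\<^bsub>Q\<^esub> \<pi> w = \<pi> (z \<oplus>\<^bsub>L\<^esub> w)" if z: "z \<in> carrier L" and w: "w \<in> carrier L" for z w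
  proof -
    obtain k l where "k \<in> X" "l \<in> X" "rep (\<pi> z) = z \<oplus>\<^bsub>L\<^esub> k" "rep (\<pi> w) = w \<oplus>\<^bsub>L\<^esub> l"
      using rep[OF z] rep[OF w] by blast
    moreover from this have "rep (\<pi> z) \<oplus>\<^bsub>L\<^esub> rep (\<pi> w) = (z \<oplus>\<^bsub>L\<^esub> w) \<oplus>\<^bsub>L\<^esub> (k \<oplus>\<^bsub>L\<^esub> l)"
      using z w Xc[of k] Xc[of l] by (simp add: L.M.add.m_ac)
    ultimately show ?thesis using \<pi>_shift[of "z \<oplus>\<^bsub>L\<^esub> w" "k \<oplus>\<^bsub>L\<^esub> l"] z w Xa by (simp add: Q_def)
  qed
  have Q_smult: "a \<odot>\<^bsub>Q\<^esub> \<pi> z = \<pi> (a \<odot>\<^bsub>L\<^esub> z)" if a: "a \<in> carrier R" and z: "z \<in> carrier L" for a z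
  proof -
    obtain k where "k \<in> X" "rep (\<pi> z) = z \<oplus>\<^bsub>L\<^esub> k"
      using rep[OF z] by blast
    moreover from this have "a \<odot>\<^bsub>L\<^esub> rep (\<pi> z) = a \<odot>\<^bsub>L\<^esub> z \<oplus>\<^bsub>L\<^esub> a \<odot>\<^bsub>L\<^esub> k"
      using a z Xc[of k] by (simp add: L.smult_r_distr)
    ultimately show ?thesis using \<pi>_shift[of "a \<odot>\<^bsub>L\<^esub> z" "a \<odot>\<^bsub>L\<^esub> k"] a z Xs by (simp add: Q_def)
  qed
  have Q_carrier: "carrier Q = \<pi> ` carrier L" and Q_zero: "\<zero>\<^bsub>Q\<^esub> = \<pi> \<zero>\<^bsub>L\<^esub>"
    by (simp_all add: Q_def)
  have Q: "left_module R Q"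
  proof (intro left_moduleI abelian_groupI L.R.ring_axioms)
    show "\<exists>B\<in>carrier Q. B \<oplus>\<^bsub>Q\<^esub> A = \<zero>\<^bsub>Q\<^esub>" if A: "A \<in> carrier Q" for A
    proof -
      obtain z where z: "z \<in> carrier L" "A = \<pi> z" using A Q_carrier by auto
      then have "\<pi> (\<ominus>\<^bsub>L\<^esub> z) \<oplus>\<^bsub>Q\<^esub> A = \<zero>\<^bsub>Q\<^esub>"
        by (simp add: Q_add Q_zero L.M.l_neg)
      then show ?thesis using z Q_carrier by blast
    qed
  qed (auto simp: Q_carrier Q_zero Q_add Q_smult L.M.add.m_ac
      L.smult_l_distr L.smult_r_distr L.smult_assoc1)
  moreover have "\<pi> \<in> lmod_epi R L Q"
    by (auto simp: lmod_epi_def Q_carrier Q_add Q_smult intro!: lmod_homI)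
  ultimately show ?thesis using \<pi>_eq that by blast
qed

text \<open>A set map \<open>r\<close> that is linear only up to \<open>X\<close> becomes a
  homomorphism after passing to \<open>L/X\<close>, and lifting it along the projection gives a
  homomorphism congruent to \<open>r\<close>. Since the error lies in \<open>X\<close>, the lift has
  its values in any submodule that contains \<open>X\<close> and the values of
  \<open>r\<close>.\<close>

lemma rel_projective_lift_modulo:
  fixes M :: "('r, 'm, 'y) module_scheme" and L :: "('r, 'l, 'z) module_scheme"
  assumes "left_module R L" and proj: "rel_projective R M L" and X: "submodule X R L"
    and r: "\<And>x. x \<in> carrier M \<Longrightarrow> r x \<in> carrier L"
    and add: "\<And>x y. \<lbrakk>x \<in> carrier M; y \<in> carrier M\<rbrakk> \<Longrightarrow>
      \<exists>k\<in>X. r x \<oplus>\<^bsub>L\<^esub> r y = r (x \<oplus>\<^bsub>M\<^esub> y) \<oplus>\<^bsub>L\<^esub> k"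
    and smult: "\<And>a x. \<lbrakk>a \<in> carrier R; x \<in> carrier M\<rbrakk> \<Longrightarrow>
      \<exists>k\<in>X. a \<odot>\<^bsub>L\<^esub> r x = r (a \<odot>\<^bsub>M\<^esub> x) \<oplus>\<^bsub>L\<^esub> k"
    and M: "left_module R M"
  obtains \<beta> where "\<beta> \<in> lmod_hom R M L" "\<And>x. x \<in> carrier M \<Longrightarrow> \<exists>k\<in>X. \<beta> x = r x \<oplus>\<^bsub>L\<^esub> k"
proof -
  interpret L: left_module R L by fact
  interpret M: left_module R M by fact
  obtain Q :: "('r, 'l set) module" and \<pi> where Q: "left_module R Q" and \<pi>: "\<pi> \<in> lmod_epi R L Q"
    and eq: "\<And>z w. \<lbrakk>z \<in> carrier L; w \<in> carrier L\<rbrakk> \<Longrightarrow> \<pi> z = \<pi> w \<longleftrightarrow> (\<exists>k\<in>X. w = z \<oplus>\<^bsub>L\<^esub> k)"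
    using quotient_module_exists[OF \<open>left_module R L\<close> X] by blast
  have \<pi>h: "\<pi> \<in> lmod_hom R L Q" using \<pi> by (simp add: lmod_epi_def)
  have "\<pi> \<circ> r \<in> lmod_hom R M Q"
  proof (rule lmod_homI)
    show "(\<pi> \<circ> r) (x \<oplus>\<^bsub>M\<^esub> y) = (\<pi> \<circ> r) x \<oplus>\<^bsub>Q\<^esub> (\<pi> \<circ> r) y" if "x \<in> carrier M" "y \<in> carrier M" for x y
      using eq[of "r (x \<oplus>\<^bsub>M\<^esub> y)" "r x \<oplus>\<^bsub>L\<^esub> r y"] add[OF that] that r lmod_homD(2)[OF \<pi>h] by simp
    show "(\<pi> \<circ> r) (a \<odot>\<^bsub>M\<^esub> x) = a \<odot>\<^bsub>Q\<^esub> (\<pi> \<circ> r) x" if "a \<in> carrier R" "x \<in> carrier M" for a x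
      using eq[of "r (a \<odot>\<^bsub>M\<^esub> x)" "a \<odot>\<^bsub>L\<^esub> r x"] smult[OF that] that r lmod_homD(3)[OF \<pi>h] by simp
  qed (use r lmod_homD(1)[OF \<pi>h] in simp)
  then obtain \<beta> where \<beta>: "\<beta> \<in> lmod_hom R M L" "\<forall>x\<in>carrier M. \<pi> (\<beta> x) = (\<pi> \<circ> r) x"
    using proj Q \<pi> unfolding rel_projective_def by blast
  show ?thesis
  proof
    show "\<exists>k\<in>X. \<beta> x = r x \<oplus>\<^bsub>L\<^esub> k" if x: "x \<in> carrier M" for x
      using \<beta>(2) x eq[OF r[OF x] lmod_homD(1)[OF \<beta>(1) x]] by simp
  qed (rule \<beta>(1))
qed

section \<open>Direct powers: projectivity and the summation map\<close>

lemma direct_power_simps: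
  "z \<in> carrier (direct_power M \<Lambda>) \<longleftrightarrow> z \<in> \<Lambda> \<rightarrow>\<^sub>E carrier M \<and> finite {i \<in> \<Lambda>. z i \<noteq> \<zero>\<^bsub>M\<^esub>}"
  "\<zero>\<^bsub>direct_power M \<Lambda>\<^esub> = (\<lambda>i\<in>\<Lambda>. \<zero>\<^bsub>M\<^esub>)"
  "z \<oplus>\<^bsub>direct_power M \<Lambda>\<^esub> w = (\<lambda>i\<in>\<Lambda>. z i \<oplus>\<^bsub>M\<^esub> w i)"
  "a \<odot>\<^bsub>direct_power M \<Lambda>\<^esub> z = (\<lambda>i\<in>\<Lambda>. a \<odot>\<^bsub>M\<^esub> z i)"
  by (auto simp: direct_power_def)

text \<open>The dual basis needs the index set \<open>carrier M\<close>, whose type is not the one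
  fixed in \<open>direct_power_projective\<close>.\<close>

lemma rel_projective_direct_power:
  assumes "left_module R M" "direct_power_projective R M"
  shows "rel_projective R M (direct_power M \<Lambda>)"
  unfolding rel_projective_def using direct_power_projective_lift[OF assms] by blast

text \<open>The power over \<open>{()}\<close> is a copy of \<open>M\<close> through evaluation, so
  composing with \<open>ev\<close> turns an epimorphism from \<open>M\<close> into one from a direct
  power.\<close>

lemma rel_projective_self:
  assumes M: "left_module R M" and proj: "direct_power_projective R M"
  shows "rel_projective R M M"
  unfolding rel_projective_def
proof (intro allI impI, elim conjE)
  fix L' :: "('a, 'c set) module" and \<rho> \<alpha>
  assume L': "left_module R L'" and \<rho>: "\<rho> \<in> lmod_epi R M L'" and \<alpha>: "\<alpha> \<in> lmod_hom R M L'"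
  let ?P = "direct_power M {()}"
  define ev where "ev z = z ()" for z :: "unit \<Rightarrow> 'c"
  have ev: "ev \<in> lmod_hom R ?P M"
    by (auto simp: lmod_hom_def ev_def direct_power_simps)
  have "x \<in> ev ` carrier ?P" if "x \<in> carrier M" for x
    using that by (intro image_eqI[of _ _ "\<lambda>i\<in>{()}. x"]) (auto simp: ev_def direct_power_simps)
  then have surj: "ev ` carrier ?P = carrier M" using lmod_homD(1)[OF ev] by (auto 0 0)
  have "(\<rho> \<circ> ev) ` carrier ?P = \<rho> ` (ev ` carrier ?P)" by (rule image_comp[symmetric])
  also have "\<dots> = carrier L'" unfolding surj using \<rho> by (simp add: lmod_epi_def)
  finally have "(\<rho> \<circ> ev) ` carrier ?P = carrier L'" .
  then have "\<rho> \<circ> ev \<in> lmod_epi R ?P L'"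
    using \<rho> lmod_hom_comp[of \<rho> R M L' ev ?P] ev by (simp add: lmod_epi_def)
  then obtain \<beta> where "\<beta> \<in> lmod_hom R M ?P" "\<forall>x\<in>carrier M. (\<rho> \<circ> ev) (\<beta> x) = \<alpha> x"
    using direct_power_projective_lift[OF M proj L' _ \<alpha>] by blast
  then show "\<exists>\<beta>\<in>lmod_end R M. \<forall>x\<in>carrier M. \<rho> (\<beta> x) = \<alpha> x"
    using lmod_hom_comp[OF ev] by (intro bexI[of _ "ev \<circ> \<beta>"]) auto
qed

text \<open>The sum runs over the support because \<open>finsum\<close> over an infinite index set
  returns only a default value.\<close>

definition direct_power_sum :: "('r, 'm, 'y) module_scheme \<Rightarrow> 'i set \<Rightarrow> ('i \<Rightarrow> 'm) \<Rightarrow> 'm"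
  where "direct_power_sum M \<Lambda> z = (\<Oplus>\<^bsub>M\<^esub>i\<in>{i \<in> \<Lambda>. z i \<noteq> \<zero>\<^bsub>M\<^esub>}. z i)"

lemma (in left_module) direct_power_sum_eq:
  assumes "finite G" "G \<subseteq> \<Lambda>" "{i \<in> \<Lambda>. z i \<noteq> \<zero>\<^bsub>M\<^esub>} \<subseteq> G" "z \<in> \<Lambda> \<rightarrow> carrier M"
  shows "direct_power_sum M \<Lambda> z = (\<Oplus>\<^bsub>M\<^esub>i\<in>G. z i)"
  unfolding direct_power_sum_def
  by (rule M.add.finprod_mono_neutral_cong_left) (use assms in auto)

lemma (in left_module) direct_power_sum_hom:
  "direct_power_sum M \<Lambda> \<in> lmod_hom R (direct_power M \<Lambda>) M"
proof (rule lmod_homI)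
  let ?P = "direct_power M \<Lambda>" and ?s = "direct_power_sum M \<Lambda>"
  interpret P: left_module R ?P by (rule left_module_direct_power)
  have fin: "finite {i \<in> \<Lambda>. z i \<noteq> \<zero>\<^bsub>M\<^esub>}" and Pi: "z \<in> \<Lambda> \<rightarrow> carrier M" if "z \<in> carrier ?P" for z
    using that by (auto simp: direct_power_simps)
  show "?s z \<in> carrier M" if "z \<in> carrier ?P" for z
    unfolding direct_power_sum_def using Pi[OF that] by (intro M.finsum_closed) auto
  show "?s (z \<oplus>\<^bsub>?P\<^esub> w) = ?s z \<oplus>\<^bsub>M\<^esub> ?s w" if z: "z \<in> carrier ?P" and w: "w \<in> carrier ?P" for z w
  proof -
    define G where "G = {i \<in> \<Lambda>. z i \<noteq> \<zero>\<^bsub>M\<^esub>} \<union> {i \<in> \<Lambda>. w i \<noteq> \<zero>\<^bsub>M\<^esub>}"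
    have G: "finite G" "G \<subseteq> \<Lambda>" using fin[OF z] fin[OF w] by (auto simp: G_def)
    have "z \<oplus>\<^bsub>?P\<^esub> w \<in> carrier ?P" using z w by simp
    note Pi' = Pi[OF this]
    have "{i \<in> \<Lambda>. (z \<oplus>\<^bsub>?P\<^esub> w) i \<noteq> \<zero>\<^bsub>M\<^esub>} \<subseteq> G"
      by (auto simp: G_def direct_power_simps)
    then have "?s (z \<oplus>\<^bsub>?P\<^esub> w) = (\<Oplus>\<^bsub>M\<^esub>i\<in>G. (z \<oplus>\<^bsub>?P\<^esub> w) i)"
      using G Pi' by (intro direct_power_sum_eq)
    also have "\<dots> = (\<Oplus>\<^bsub>M\<^esub>i\<in>G. z i \<oplus>\<^bsub>M\<^esub> w i)"
      using G Pi[OF z] Pi[OF w] by (intro M.finsum_cong') (auto simp: direct_power_simps)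
    also have "\<dots> = (\<Oplus>\<^bsub>M\<^esub>i\<in>G. z i) \<oplus>\<^bsub>M\<^esub> (\<Oplus>\<^bsub>M\<^esub>i\<in>G. w i)"
      using G Pi[OF z] Pi[OF w] by (intro M.finsum_addf) auto
    also have "\<dots> = ?s z \<oplus>\<^bsub>M\<^esub> ?s w"
      using G Pi[OF z] Pi[OF w] direct_power_sum_eq[of G \<Lambda>] by (simp add: G_def)
    finally show ?thesis .
  qed
  show "?s (a \<odot>\<^bsub>?P\<^esub> z) = a \<odot>\<^bsub>M\<^esub> ?s z" if a: "a \<in> carrier R" and z: "z \<in> carrier ?P" for a z
  proof -
    define G where "G = {i \<in> \<Lambda>. z i \<noteq> \<zero>\<^bsub>M\<^esub>}"
    have G: "finite G" "G \<subseteq> \<Lambda>" using fin[OF z] by (auto simp: G_def)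
    have "a \<odot>\<^bsub>?P\<^esub> z \<in> carrier ?P" using a z by simp
    note Pi' = Pi[OF this]
    have "{i \<in> \<Lambda>. (a \<odot>\<^bsub>?P\<^esub> z) i \<noteq> \<zero>\<^bsub>M\<^esub>} \<subseteq> G"
      using a by (auto simp: G_def direct_power_simps smult_zero_right)
    then have "?s (a \<odot>\<^bsub>?P\<^esub> z) = (\<Oplus>\<^bsub>M\<^esub>i\<in>G. (a \<odot>\<^bsub>?P\<^esub> z) i)"
      using G Pi' by (intro direct_power_sum_eq)
    also have "\<dots> = (\<Oplus>\<^bsub>M\<^esub>i\<in>G. a \<odot>\<^bsub>M\<^esub> z i)"
      using a G Pi[OF z] by (intro M.finsum_cong') (auto simp: direct_power_simps)
    also have "\<dots> = a \<odot>\<^bsub>M\<^esub> ?s z"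
      using a G Pi[OF z] unfolding direct_power_sum_def G_def by (intro finsum_smult) auto
    finally show ?thesis .
  qed
qed

text \<open>The direct sum \<open>Y\<close> of all \<open>R y\<close> sits inside the power of
  \<open>M\<close> indexed by \<open>M\<close> itself and maps onto \<open>M\<close> by summation,
  with kernel \<open>X\<close>. Projectivity is available for the whole power; lifting modulo
  \<open>X\<close> inside the power still ends up in \<open>Y\<close>, because \<open>X\<close> and
  the values of \<open>r\<close> lie there. The components of the splitting \<open>\<beta>\<close>
  are the maps \<open>\<phi> y\<close>.\<close>

lemma dual_basis:
  assumes M: "left_module R M" and proj: "direct_power_projective R M"
  obtains \<phi> where "\<forall>y\<in>carrier M. \<phi> y \<in> lmod_end R M"
    and "\<forall>y\<in>carrier M. \<forall>x\<in>carrier M. \<phi> y x \<in> (\<lambda>a. a \<odot>\<^bsub>M\<^esub> y) ` carrier R"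
    and "\<forall>x\<in>carrier M. finite {y \<in> carrier M. \<phi> y x \<noteq> \<zero>\<^bsub>M\<^esub>} \<and>
      (\<Oplus>\<^bsub>M\<^esub>y\<in>{y \<in> carrier M. \<phi> y x \<noteq> \<zero>\<^bsub>M\<^esub>}. \<phi> y x) = x"
proof -
  interpret M: left_module R M by fact
  let ?P = "direct_power M (carrier M)"
  let ?s = "direct_power_sum M (carrier M)"
  interpret P: left_module R ?P by (rule M.left_module_direct_power)
  define Y where "Y = {z \<in> carrier ?P. \<forall>y\<in>carrier M. z y \<in> (\<lambda>a. a \<odot>\<^bsub>M\<^esub> y) ` carrier R}"
  have cyc: "submodule ((\<lambda>a. a \<odot>\<^bsub>M\<^esub> y) ` carrier R) R M" if "y \<in> carrier M" for y
    using M.submodule_cyclic[OF that] .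
  have Y: "submodule Y R ?P"
  proof (rule P.submoduleI)
    show "\<zero>\<^bsub>?P\<^esub> \<in> Y"
      using M.submoduleD(3)[OF cyc] P.M.zero_closed by (simp add: Y_def direct_power_simps)
    show "z \<oplus>\<^bsub>?P\<^esub> w \<in> Y" if "z \<in> Y" "w \<in> Y" for z w
      using that M.submoduleD(4)[OF cyc] P.M.add.m_closed[of z w]
      by (simp add: Y_def direct_power_simps)
    show "a \<odot>\<^bsub>?P\<^esub> z \<in> Y" if "a \<in> carrier R" "z \<in> Y" for a z
      using that M.submoduleD(5)[OF cyc] P.smult_closed[of a z]
      by (simp add: Y_def direct_power_simps)
  qed (auto simp: Y_def)
  have s: "?s \<in> lmod_hom R ?P M" by (rule M.direct_power_sum_hom)
  note s0 = lmod_hom_zero[OF P.left_module_axioms M s]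
  define X where "X = {z \<in> Y. ?s z = \<zero>\<^bsub>M\<^esub>}"
  have YP: "z \<in> carrier ?P" if "z \<in> Y" for z using that by (simp add: Y_def)
  have X: "submodule X R ?P"
  proof (rule P.submoduleI)
    show "X \<subseteq> carrier ?P" using YP by (auto simp: X_def)
    show "\<zero>\<^bsub>?P\<^esub> \<in> X" using P.submoduleD(3)[OF Y] s0 by (simp add: X_def)
    show "z \<oplus>\<^bsub>?P\<^esub> w \<in> X" if "z \<in> X" "w \<in> X" for z w
      using that P.submoduleD(4)[OF Y] YP lmod_homD(2)[OF s] by (simp add: X_def)
    show "a \<odot>\<^bsub>?P\<^esub> z \<in> X" if "a \<in> carrier R" "z \<in> X" for a z
      using that P.submoduleD(5)[OF Y] YP lmod_homD(3)[OF s] M.smult_zero_right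
      by (simp add: X_def)
  qed
  \<comment> \<open>The linearity conditions on \<open>r\<close> compare elements of
    \<open>Y\<close> with equal sums; this turns equality of sums into congruence modulo
    \<open>X\<close>.\<close>
  have diff: "\<exists>k\<in>X. u = v \<oplus>\<^bsub>?P\<^esub> k" if u: "u \<in> Y" and v: "v \<in> Y" and eq: "?s u = ?s v" for u v
  proof
    let ?k = "\<ominus>\<^bsub>?P\<^esub> v \<oplus>\<^bsub>?P\<^esub> u"
    have k: "?k \<in> Y" using P.submoduleD(4,6)[OF Y] u v by simp
    show uk: "u = v \<oplus>\<^bsub>?P\<^esub> ?k"
      using YP[OF u] YP[OF v] by (simp add: P.M.a_assoc[symmetric] P.M.r_neg)
    have "?s u = ?s v \<oplus>\<^bsub>M\<^esub> ?s ?k"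
      using lmod_homD(2)[OF s YP[OF v] YP[OF k]] uk by simp
    then have "?s ?k = \<zero>\<^bsub>M\<^esub>"
      using eq lmod_homD(1)[OF s YP[OF v]] lmod_homD(1)[OF s YP[OF k]] by simp
    with k show "?k \<in> X" by (simp add: X_def)
  qed
  \<comment> \<open>\<open>r x\<close> has the entry \<open>x\<close> at position \<open>x\<close>:
    the obvious preimage of \<open>x\<close> under summation, in general additive only modulo
    \<open>X\<close>.\<close>
  define r where "r x = (\<lambda>i\<in>carrier M. if i = x then x else \<zero>\<^bsub>M\<^esub>)" for x
  have r: "r x \<in> Y" "?s (r x) = x" if x: "x \<in> carrier M" for x
  proof -
    have sub: "{i \<in> carrier M. r x i \<noteq> \<zero>\<^bsub>M\<^esub>} \<subseteq> {x}" by (auto simp: r_def)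
    then have fin: "finite {i \<in> carrier M. r x i \<noteq> \<zero>\<^bsub>M\<^esub>}" by (rule finite_subset) simp
    have "x = \<one>\<^bsub>R\<^esub> \<odot>\<^bsub>M\<^esub> x" using x by simp
    then have "x \<in> (\<lambda>a. a \<odot>\<^bsub>M\<^esub> x) ` carrier R" by blast
    then show "r x \<in> Y"
      using x fin M.submoduleD(3)[OF cyc] by (auto simp: Y_def direct_power_simps r_def)
    have "?s (r x) = (\<Oplus>\<^bsub>M\<^esub>i\<in>{x}. r x i)"
      using sub x by (intro M.direct_power_sum_eq) (auto simp: r_def)
    also have "\<dots> = x" using x by (subst M.M.finsum_insert) (auto simp: r_def)
    finally show "?s (r x) = x" .
  qed
  obtain \<beta> where \<beta>: "\<beta> \<in> lmod_hom R M ?P" and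
    \<beta>r: "\<And>x. x \<in> carrier M \<Longrightarrow> \<exists>k\<in>X. \<beta> x = r x \<oplus>\<^bsub>?P\<^esub> k"
  proof (rule rel_projective_lift_modulo[OF P.left_module_axioms
        rel_projective_direct_power[OF M proj] X, of r])
    show "\<exists>k\<in>X. r x \<oplus>\<^bsub>?P\<^esub> r y = r (x \<oplus>\<^bsub>M\<^esub> y) \<oplus>\<^bsub>?P\<^esub> k"
      if "x \<in> carrier M" "y \<in> carrier M" for x y
      by (rule diff) (use that r YP lmod_homD(2)[OF s] P.submoduleD(4)[OF Y] in simp_all)
    show "\<exists>k\<in>X. a \<odot>\<^bsub>?P\<^esub> r x = r (a \<odot>\<^bsub>M\<^esub> x) \<oplus>\<^bsub>?P\<^esub> k"
      if "a \<in> carrier R" "x \<in> carrier M" for a x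
      by (rule diff) (use that r YP lmod_homD(3)[OF s] P.submoduleD(5)[OF Y] in simp_all)
  qed (use r YP M in auto)
  have \<beta>Y: "\<beta> x \<in> Y" "?s (\<beta> x) = x" if x: "x \<in> carrier M" for x
  proof -
    obtain k where k: "k \<in> X" "\<beta> x = r x \<oplus>\<^bsub>?P\<^esub> k" using \<beta>r[OF x] by blast
    then have kY: "k \<in> Y" "?s k = \<zero>\<^bsub>M\<^esub>" by (auto simp: X_def)
    show "\<beta> x \<in> Y" using k(2) kY(1) r(1)[OF x] P.submoduleD(4)[OF Y] by simp
    show "?s (\<beta> x) = x"
      using k(2) kY r[OF x] x YP lmod_homD(2)[OF s] by simp
  qed
  show ?thesis
  proof
    show "\<forall>y\<in>carrier M. (\<lambda>x. \<beta> x y) \<in> lmod_end R M"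
    proof (intro ballI lmod_homI)
      show "\<beta> x y \<in> carrier M" if "y \<in> carrier M" "x \<in> carrier M" for x y
        using YP[OF \<beta>Y(1)[OF that(2)]] that(1) by (auto simp: direct_power_simps)
    qed (use lmod_homD[OF \<beta>] in \<open>auto simp: direct_power_simps\<close>)
    show "\<forall>y\<in>carrier M. \<forall>x\<in>carrier M. \<beta> x y \<in> (\<lambda>a. a \<odot>\<^bsub>M\<^esub> y) ` carrier R"
      using \<beta>Y(1) by (auto simp: Y_def)
    show "\<forall>x\<in>carrier M. finite {y \<in> carrier M. \<beta> x y \<noteq> \<zero>\<^bsub>M\<^esub>} \<and>
      (\<Oplus>\<^bsub>M\<^esub>y\<in>{y \<in> carrier M. \<beta> x y \<noteq> \<zero>\<^bsub>M\<^esub>}. \<beta> x y) = x"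
    proof (intro ballI conjI)
      fix x assume x: "x \<in> carrier M"
      show "finite {y \<in> carrier M. \<beta> x y \<noteq> \<zero>\<^bsub>M\<^esub>}"
        using YP[OF \<beta>Y(1)[OF x]] by (simp add: direct_power_simps)
      show "(\<Oplus>\<^bsub>M\<^esub>y\<in>{y \<in> carrier M. \<beta> x y \<noteq> \<zero>\<^bsub>M\<^esub>}. \<beta> x y) = x"
        using \<beta>Y(2)[OF x] by (simp add: direct_power_sum_def)
    qed
  qed
qed

section \<open>Prime submodules avoiding a sequence\<close>

text \<open>This is the isomorphism of \<open>(B + P)/P\<close> with \<open>B/(B \<inter> P)\<close>
  in terms of lifts. The \<open>B\<close>-part \<open>r\<close> of \<open>f\<close> is determined up
  to \<open>B \<inter> P\<close>, hence linear modulo \<open>B \<inter> P\<close>; a lift of it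
  stays in \<open>B\<close> and differs from \<open>f\<close> by values in \<open>P\<close>.\<close>

lemma rel_projective_fun_eq_mod:
  fixes M :: "('r, 'm, 'y) module_scheme"
  assumes "left_module R M" and proj: "rel_projective R M M"
    and B: "submodule B R M" and P: "submodule P R M"
    and f: "f \<in> lmod_end R M" "\<And>x. x \<in> carrier M \<Longrightarrow> \<exists>b\<in>B. \<exists>p\<in>P. f x = b \<oplus>\<^bsub>M\<^esub> p"
  obtains g where "g \<in> lmod_end R M" "g ` carrier M \<subseteq> B"
    "\<And>x. x \<in> carrier M \<Longrightarrow> \<exists>p\<in>P. f x = g x \<oplus>\<^bsub>M\<^esub> p"
proof -
  interpret left_module R M by fact
  note cB = submoduleD(2)[OF B] and cP = submoduleD(2)[OF P]
  have diff: "\<exists>k\<in>B \<inter> P. u = v \<oplus>\<^bsub>M\<^esub> k"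
    if uv: "u \<in> B" "v \<in> B" and pq: "p \<in> P" "q \<in> P" and eq: "u \<oplus>\<^bsub>M\<^esub> p = v \<oplus>\<^bsub>M\<^esub> q" for u v p q
  proof
    let ?k = "\<ominus>\<^bsub>M\<^esub> v \<oplus>\<^bsub>M\<^esub> u"
    note c = cB[OF uv(1)] cB[OF uv(2)] cP[OF pq(1)] cP[OF pq(2)]
    show "u = v \<oplus>\<^bsub>M\<^esub> ?k" using c by (simp add: M.a_assoc[symmetric] M.r_neg)
    have "?k = ?k \<oplus>\<^bsub>M\<^esub> (p \<oplus>\<^bsub>M\<^esub> \<ominus>\<^bsub>M\<^esub> p)" using c by (simp add: M.r_neg)
    also have "\<dots> = \<ominus>\<^bsub>M\<^esub> v \<oplus>\<^bsub>M\<^esub> (u \<oplus>\<^bsub>M\<^esub> p) \<oplus>\<^bsub>M\<^esub> \<ominus>\<^bsub>M\<^esub> p" using c by (simp add: M.a_assoc)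
    also have "\<dots> = (\<ominus>\<^bsub>M\<^esub> v \<oplus>\<^bsub>M\<^esub> v) \<oplus>\<^bsub>M\<^esub> q \<oplus>\<^bsub>M\<^esub> \<ominus>\<^bsub>M\<^esub> p" unfolding eq using c by (simp add: M.a_assoc)
    also have "\<dots> = q \<oplus>\<^bsub>M\<^esub> \<ominus>\<^bsub>M\<^esub> p" using c by (simp add: M.l_neg)
    finally have "?k \<in> P" using pq submoduleD(4,6)[OF P] by simp
    then show "?k \<in> B \<inter> P" using uv submoduleD(4,6)[OF B] by simp
  qed
  have "\<forall>x\<in>carrier M. \<exists>b p. b \<in> B \<and> p \<in> P \<and> f x = b \<oplus>\<^bsub>M\<^esub> p"
    using f(2) by blast
  then obtain r s where r: "\<And>x. x \<in> carrier M \<Longrightarrow> r x \<in> B"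
    and s: "\<And>x. x \<in> carrier M \<Longrightarrow> s x \<in> P"
    and rs: "\<And>x. x \<in> carrier M \<Longrightarrow> f x = r x \<oplus>\<^bsub>M\<^esub> s x"
    by metis
  obtain g where g: "g \<in> lmod_end R M"
    and gr: "\<And>x. x \<in> carrier M \<Longrightarrow> \<exists>k\<in>B \<inter> P. g x = r x \<oplus>\<^bsub>M\<^esub> k"
  proof (rule rel_projective_lift_modulo[OF left_module_axioms proj submodule_Int[OF B P], of r])
    show "\<exists>k\<in>B \<inter> P. r x \<oplus>\<^bsub>M\<^esub> r y = r (x \<oplus>\<^bsub>M\<^esub> y) \<oplus>\<^bsub>M\<^esub> k"
      if xy: "x \<in> carrier M" "y \<in> carrier M" for x y
    proof (rule diff)
      have "f (x \<oplus>\<^bsub>M\<^esub> y) = f x \<oplus>\<^bsub>M\<^esub> f y" using lmod_homD(2)[OF f(1) xy] .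
      then show "r x \<oplus>\<^bsub>M\<^esub> r y \<oplus>\<^bsub>M\<^esub> (s x \<oplus>\<^bsub>M\<^esub> s y) = r (x \<oplus>\<^bsub>M\<^esub> y) \<oplus>\<^bsub>M\<^esub> s (x \<oplus>\<^bsub>M\<^esub> y)"
        using xy rs cB[OF r] cP[OF s] by (simp add: M.add.m_ac)
    qed (use xy r s submoduleD(4)[OF B] submoduleD(4)[OF P] in simp_all)
    show "\<exists>k\<in>B \<inter> P. a \<odot>\<^bsub>M\<^esub> r x = r (a \<odot>\<^bsub>M\<^esub> x) \<oplus>\<^bsub>M\<^esub> k"
      if ax: "a \<in> carrier R" "x \<in> carrier M" for a x
    proof (rule diff)
      have "f (a \<odot>\<^bsub>M\<^esub> x) = a \<odot>\<^bsub>M\<^esub> f x" using lmod_homD(3)[OF f(1) ax] .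
      then show "a \<odot>\<^bsub>M\<^esub> r x \<oplus>\<^bsub>M\<^esub> a \<odot>\<^bsub>M\<^esub> s x = r (a \<odot>\<^bsub>M\<^esub> x) \<oplus>\<^bsub>M\<^esub> s (a \<odot>\<^bsub>M\<^esub> x)"
        using ax rs cB[OF r] cP[OF s] by (simp add: smult_r_distr)
    qed (use ax r s submoduleD(5)[OF B] submoduleD(5)[OF P] in simp_all)
    show "r x \<in> carrier M" if "x \<in> carrier M" for x using cB[OF r[OF that]] .
  qed (use left_module_axioms in auto)
  show ?thesis
  proof
    show "g ` carrier M \<subseteq> B"
      using gr r submoduleD(4)[OF B] by fastforce
    show "\<exists>p\<in>P. f x = g x \<oplus>\<^bsub>M\<^esub> p" if x: "x \<in> carrier M" for x
    proof -
      obtain k where k: "k \<in> B" "k \<in> P" "g x = r x \<oplus>\<^bsub>M\<^esub> k" using gr[OF x] by auto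
      have "f x = g x \<oplus>\<^bsub>M\<^esub> (\<ominus>\<^bsub>M\<^esub> k \<oplus>\<^bsub>M\<^esub> s x)"
      proof -
        have "r x \<oplus>\<^bsub>M\<^esub> k \<oplus>\<^bsub>M\<^esub> (\<ominus>\<^bsub>M\<^esub> k \<oplus>\<^bsub>M\<^esub> s x) = r x \<oplus>\<^bsub>M\<^esub> (k \<oplus>\<^bsub>M\<^esub> \<ominus>\<^bsub>M\<^esub> k) \<oplus>\<^bsub>M\<^esub> s x"
          using cB[OF r[OF x]] cP[OF k(2)] cP[OF s[OF x]] by (simp add: M.a_assoc)
        then show ?thesis
          using cB[OF r[OF x]] cP[OF k(2)] cP[OF s[OF x]] rs[OF x] k(3) by (simp add: M.r_neg)
      qed
      then show ?thesis using submoduleD(4,6)[OF P] k(2) s[OF x] by blast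
    qed
  qed (rule g)
qed

section \<open>Products, fully invariant submodules and primes\<close>

context left_module
begin

lemma submodule_prod_subset:
  assumes "submodule B R M" "submodule H R M"
    and "\<And>f. \<lbrakk>f \<in> lmod_end R M; f ` carrier M \<subseteq> B\<rbrakk> \<Longrightarrow> f ` A \<subseteq> H"
  shows "submodule_prod R M A B \<subseteq> H"
  unfolding submodule_prod_def lmod_hom_carrier_update[OF submoduleD(1)[OF assms(1)]]
  by (rule submodule_sum_subset[OF assms(2)]) (use assms(3) in blast)

lemma submodule_prod_memI:
  assumes "A \<subseteq> carrier M" "submodule B R M" "f \<in> lmod_end R M" "f ` carrier M \<subseteq> B" "x \<in> A"
  shows "f x \<in> submodule_prod R M A B"
proof -
  have "f ` A \<subseteq> submodule_prod R M A B"
    unfolding submodule_prod_def lmod_hom_carrier_update[OF submoduleD(1)[OF assms(2)]]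
    by (rule submodule_sum_upper) (use assms lmod_homD(1)[OF assms(3)] in auto)
  then show ?thesis using assms(5) by blast
qed

lemma zero_in_submodule_prod: "\<zero>\<^bsub>M\<^esub> \<in> submodule_prod R M A B"
  unfolding submodule_prod_def submodule_sum_def
  by (rule CollectI, rule exI[of _ "{}"]) simp

lemma fully_invariantD:
  assumes "fully_invariant A R M"
  shows "submodule A R M" "\<lbrakk>f \<in> lmod_end R M; x \<in> A\<rbrakk> \<Longrightarrow> f x \<in> A"
  using assms by (auto simp: fully_invariant_def)

lemma fully_invariant_zero: "fully_invariant {\<zero>\<^bsub>M\<^esub>} R M"
  using lmod_end_zero by (auto simp: fully_invariant_def submodule_zero)

lemma fully_invariant_carrier: "fully_invariant (carrier M) R M"
  by (auto simp: fully_invariant_def submodule_carrier dest: lmod_homD(1))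

lemma fully_invariant_set_add:
  assumes "fully_invariant A R M" "fully_invariant B R M"
  shows "fully_invariant {a \<oplus>\<^bsub>M\<^esub> b | a b. a \<in> A \<and> b \<in> B} R M"
  unfolding fully_invariant_def
proof (intro conjI ballI subsetI)
  note A = fully_invariantD[OF assms(1)] and B = fully_invariantD[OF assms(2)]
  show "submodule {a \<oplus>\<^bsub>M\<^esub> b | a b. a \<in> A \<and> b \<in> B} R M"
    by (rule submodule_set_add(1)[OF A(1) B(1)])
  fix f y assume f: "f \<in> lmod_end R M" and "y \<in> f ` {a \<oplus>\<^bsub>M\<^esub> b | a b. a \<in> A \<and> b \<in> B}"
  then obtain a b where "a \<in> A" "b \<in> B" "y = f (a \<oplus>\<^bsub>M\<^esub> b)" by blast
  moreover from this have "y = f a \<oplus>\<^bsub>M\<^esub> f b"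
    using lmod_homD(2)[OF f] submoduleD(2)[OF A(1)] submoduleD(2)[OF B(1)] by simp
  ultimately show "y \<in> {a \<oplus>\<^bsub>M\<^esub> b | a b. a \<in> A \<and> b \<in> B}"
    using A(2)[OF f] B(2)[OF f] by blast
qed

lemma fully_invariant_chain_Union:
  assumes "\<C> \<noteq> {}" "\<And>P. P \<in> \<C> \<Longrightarrow> fully_invariant P R M"
    and chain: "\<And>P Q. \<lbrakk>P \<in> \<C>; Q \<in> \<C>\<rbrakk> \<Longrightarrow> P \<subseteq> Q \<or> Q \<subseteq> P"
  shows "fully_invariant (\<Union>\<C>) R M"
  unfolding fully_invariant_def
proof (intro conjI ballI)
  note D = fully_invariantD[OF assms(2)] and S = submoduleD[OF fully_invariantD(1)[OF assms(2)]]
  show "submodule (\<Union>\<C>) R M"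
  proof (rule submoduleI)
    show "\<Union>\<C> \<subseteq> carrier M" using S(1) by blast
    show "\<zero>\<^bsub>M\<^esub> \<in> \<Union>\<C>" using S(3) assms(1) by blast
    show "x \<oplus>\<^bsub>M\<^esub> y \<in> \<Union>\<C>" if xy: "x \<in> \<Union>\<C>" "y \<in> \<Union>\<C>" for x y
    proof -
      obtain P Q where "P \<in> \<C>" "x \<in> P" "Q \<in> \<C>" "y \<in> Q" using xy by blast
      moreover from this have "P \<subseteq> Q \<or> Q \<subseteq> P" using chain by blast
      ultimately show ?thesis using S(4) by (meson UnionI subsetD)
    qed
    show "a \<odot>\<^bsub>M\<^esub> x \<in> \<Union>\<C>" if "a \<in> carrier R" "x \<in> \<Union>\<C>" for a x
      using that S(5) by blast
  qed
  show "f ` \<Union>\<C> \<subseteq> \<Union>\<C>" if "f \<in> lmod_end R M" for f using D(2)[OF _ that] by blast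
qed

lemma fully_invariant_Inter:
  assumes "\<C> \<noteq> {}" "\<And>P. P \<in> \<C> \<Longrightarrow> fully_invariant P R M"
  shows "fully_invariant (\<Inter>\<C>) R M"
  unfolding fully_invariant_def
proof (intro conjI ballI)
  note D = fully_invariantD[OF assms(2)] and S = submoduleD[OF fully_invariantD(1)[OF assms(2)]]
  show "submodule (\<Inter>\<C>) R M"
  proof (rule submoduleI)
    show "\<Inter>\<C> \<subseteq> carrier M" using S(1) assms(1) by blast
  qed (use S(3,4,5) in auto)
  show "f ` \<Inter>\<C> \<subseteq> \<Inter>\<C>" if "f \<in> lmod_end R M" for f using D(2)[OF _ that] by blast
qed

lemma fully_invariant_prime_radical: "fully_invariant (prime_radical R M) R M"
  unfolding prime_radical_def
proof (rule fully_invariant_Inter)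
  \<comment> \<open>\<open>M\<close> itself counts as prime, so the radical is an intersection over
    a nonempty family and lies inside \<open>carrier M\<close>.\<close>
  have "prime_submodule (carrier M) R M"
    using fully_invariant_carrier submoduleD(1)[OF fully_invariantD(1)]
    by (auto simp: prime_submodule_def)
  then show "{P. prime_submodule P R M} \<noteq> {}" by blast
qed (simp add: prime_submodule_def)

text \<open>A map into \<open>B + P\<close> need not split into maps into \<open>B\<close> and
  \<open>P\<close>. Projectivity repairs this modulo \<open>P\<close>: the map agrees with some
  \<open>g\<close> into \<open>B\<close>, which sends \<open>A\<close> into the product of
  \<open>A\<close> and \<open>B\<close>, while full invariance takes care of the summand
  \<open>P\<close> on the left.\<close>

lemma submodule_prod_set_add_subset:
  assumes proj: "rel_projective R M M"
    and A: "fully_invariant A R M" and B: "fully_invariant B R M" and P: "fully_invariant P R M"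
    and AB: "submodule_prod R M A B \<subseteq> P"
  shows "submodule_prod R M {a \<oplus>\<^bsub>M\<^esub> p | a p. a \<in> A \<and> p \<in> P} {b \<oplus>\<^bsub>M\<^esub> p | b p. b \<in> B \<and> p \<in> P} \<subseteq> P"
proof (rule submodule_prod_subset)
  note A' = fully_invariantD[OF A] and B' = fully_invariantD[OF B] and P' = fully_invariantD[OF P]
  show "submodule {b \<oplus>\<^bsub>M\<^esub> p | b p. b \<in> B \<and> p \<in> P} R M"
    by (rule submodule_set_add(1)[OF B'(1) P'(1)])
  show "submodule P R M" by (rule P'(1))
  fix f assume f: "f \<in> lmod_end R M"
    and fB: "f ` carrier M \<subseteq> {b \<oplus>\<^bsub>M\<^esub> p | b p. b \<in> B \<and> p \<in> P}"
  have "\<exists>b\<in>B. \<exists>p\<in>P. f x = b \<oplus>\<^bsub>M\<^esub> p" if "x \<in> carrier M" for x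
    using fB that by blast
  then obtain g where g: "g \<in> lmod_end R M" "g ` carrier M \<subseteq> B"
    "\<And>x. x \<in> carrier M \<Longrightarrow> \<exists>p\<in>P. f x = g x \<oplus>\<^bsub>M\<^esub> p"
    using rel_projective_fun_eq_mod[OF left_module_axioms proj B'(1) P'(1) f] by blast
  have "f a \<in> P" if a: "a \<in> A" for a
  proof -
    have "g a \<in> P"
      using submodule_prod_memI[OF submoduleD(1)[OF A'(1)] B'(1) g(1,2) a] AB by blast
    then show ?thesis
      using g(3)[OF submoduleD(2)[OF A'(1) a]] submoduleD(4)[OF P'(1)] by auto
  qed
  then have "f (a \<oplus>\<^bsub>M\<^esub> p) \<in> P" if "a \<in> A" "p \<in> P" for a p
    using that P'(2)[OF f that(2)] submoduleD(4)[OF P'(1)]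
      lmod_homD(2)[OF f submoduleD(2)[OF A'(1) that(1)] submoduleD(2)[OF P'(1) that(2)]]
    by simp
  then show "f ` {a \<oplus>\<^bsub>M\<^esub> p | a p. a \<in> A \<and> p \<in> P} \<subseteq> P" by blast
qed

text \<open>The condition on \<open>z\<close> is the analogue of an m-sequence. A fully invariant
  \<open>P\<close> maximal among those missing every \<open>z n\<close> is prime: if
  \<open>A\<close> and \<open>B\<close> are not below \<open>P\<close>, then \<open>A + P\<close>
  and \<open>B + P\<close> both contain terms, hence a common later term, and the next term falls
  into their product, which lies in \<open>P\<close> as soon as the product of \<open>A\<close> and
  \<open>B\<close> does.\<close>

lemma prime_submodule_avoiding_sequence:
  fixes z :: "nat \<Rightarrow> 'c"
  assumes proj: "rel_projective R M M"
    and z: "\<And>n. z n \<in> carrier M" "\<And>n. z n \<noteq> \<zero>\<^bsub>M\<^esub>"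
    and step: "\<And>n A B. \<lbrakk>fully_invariant A R M; fully_invariant B R M; z n \<in> A; z n \<in> B\<rbrakk> \<Longrightarrow>
      z (Suc n) \<in> submodule_prod R M A B"
  obtains P where "prime_submodule P R M" "z 0 \<notin> P"
proof -
  define \<A> where "\<A> = {P. fully_invariant P R M \<and> (\<forall>n. z n \<notin> P)}"
  have "\<exists>P\<in>\<A>. \<forall>Q\<in>\<A>. P \<subseteq> Q \<longrightarrow> Q = P"
  proof (rule subset_Zorn_nonempty)
    show "\<A> \<noteq> {}" using fully_invariant_zero z(2) by (auto simp: \<A>_def)
    show "\<Union>\<C> \<in> \<A>" if \<C>: "\<C> \<noteq> {}" "subset.chain \<A> \<C>" for \<C>
    proof -
      have "\<C> \<subseteq> \<A>" and "\<And>P Q. P \<in> \<C> \<Longrightarrow> Q \<in> \<C> \<Longrightarrow> P \<subseteq> Q \<or> Q \<subseteq> P"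
        using \<C>(2) by (auto simp: subset_chain_def)
      then have "fully_invariant (\<Union>\<C>) R M"
        by (intro fully_invariant_chain_Union[OF \<C>(1)]) (auto simp: \<A>_def)
      then show ?thesis using \<open>\<C> \<subseteq> \<A>\<close> unfolding \<A>_def by blast
    qed
  qed
  then obtain P where P\<A>: "P \<in> \<A>" and maxP: "\<And>Q. Q \<in> \<A> \<Longrightarrow> P \<subseteq> Q \<Longrightarrow> Q = P"
    by blast
  have P: "fully_invariant P R M" "\<And>n. z n \<notin> P" using P\<A> by (auto simp: \<A>_def)
  have max: "\<exists>n. z n \<in> Q" if "fully_invariant Q R M" "P \<subseteq> Q" "Q \<noteq> P" for Q
    using maxP[of Q] that by (auto simp: \<A>_def)
  have later: "z m \<in> Q" if Q: "fully_invariant Q R M" "z n \<in> Q" and "n \<le> m" for Q n m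
    using \<open>n \<le> m\<close>
  proof (induction m rule: dec_induct)
    case (step m)
    have "submodule_prod R M Q Q \<subseteq> Q"
      using fully_invariantD[OF Q(1)] by (intro submodule_prod_subset) auto
    then show ?case using assms(4)[OF Q(1) Q(1) step.IH step.IH] by blast
  qed (rule Q(2))
  have meets: "\<exists>n. z n \<in> {a \<oplus>\<^bsub>M\<^esub> p | a p. a \<in> A \<and> p \<in> P}"
    if A: "fully_invariant A R M" "\<not> A \<subseteq> P" for A
  proof (rule max)
    note S = submodule_set_add(2,3)[OF fully_invariantD(1)[OF A(1)] fully_invariantD(1)[OF P(1)]]
    show "P \<subseteq> {a \<oplus>\<^bsub>M\<^esub> p | a p. a \<in> A \<and> p \<in> P}" by (rule S(2))
    show "{a \<oplus>\<^bsub>M\<^esub> p | a p. a \<in> A \<and> p \<in> P} \<noteq> P" using S(1) A(2) by metis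
  qed (rule fully_invariant_set_add[OF A(1) P(1)])
  have "A \<subseteq> P \<or> B \<subseteq> P"
    if A: "fully_invariant A R M" and B: "fully_invariant B R M"
      and AB: "submodule_prod R M A B \<subseteq> P" for A B
  proof (rule ccontr)
    assume "\<not> (A \<subseteq> P \<or> B \<subseteq> P)"
    then have "\<not> A \<subseteq> P" "\<not> B \<subseteq> P" by simp_all
    obtain m where m: "z m \<in> {a \<oplus>\<^bsub>M\<^esub> p | a p. a \<in> A \<and> p \<in> P}"
      using meets[OF A \<open>\<not> A \<subseteq> P\<close>] by (elim exE)
    obtain n where n: "z n \<in> {b \<oplus>\<^bsub>M\<^esub> p | b p. b \<in> B \<and> p \<in> P}"
      using meets[OF B \<open>\<not> B \<subseteq> P\<close>] by (elim exE)
    have "z (Suc (max m n)) \<in>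
      submodule_prod R M {a \<oplus>\<^bsub>M\<^esub> p | a p. a \<in> A \<and> p \<in> P} {b \<oplus>\<^bsub>M\<^esub> p | b p. b \<in> B \<and> p \<in> P}"
    proof (rule step)
      show A': "fully_invariant {a \<oplus>\<^bsub>M\<^esub> p | a p. a \<in> A \<and> p \<in> P} R M"
        by (rule fully_invariant_set_add[OF A P(1)])
      show B': "fully_invariant {b \<oplus>\<^bsub>M\<^esub> p | b p. b \<in> B \<and> p \<in> P} R M"
        by (rule fully_invariant_set_add[OF B P(1)])
      show "z (max m n) \<in> {a \<oplus>\<^bsub>M\<^esub> p | a p. a \<in> A \<and> p \<in> P}"
        by (rule later[OF A' m]) simp
      show "z (max m n) \<in> {b \<oplus>\<^bsub>M\<^esub> p | b p. b \<in> B \<and> p \<in> P}"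
        by (rule later[OF B' n]) simp
    qed
    then show False
      using subsetD[OF submodule_prod_set_add_subset[OF proj A B P(1) AB]] P(2) by iprover
  qed
  then have "prime_submodule P R M" using P(1) by (simp add: prime_submodule_def)
  then show ?thesis using P(2) that by blast
qed

lemma lmod_end_funpow:
  assumes "h \<in> lmod_end R M"
  shows "h ^^ n \<in> lmod_end R M"
proof (induction n)
  case (Suc n)
  then show ?case using lmod_hom_comp[OF assms] by (simp only: funpow.simps)
qed (simp only: funpow.simps id_in_lmod_end)

text \<open>The elements \<open>z, h z, h\<^sup>3 z, h\<^sup>7 z, \<dots>\<close> satisfy the hypothesis of
  \<open>prime_submodule_avoiding_sequence\<close>, because \<open>h\<^sup>k\<^sup>+\<^sup>1\<close> maps \<open>M\<close> into the submodule
  generated by \<open>h\<^sup>k z\<close>.\<close>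

lemma funpow_eventually_zero:
  assumes proj: "rel_projective R M M"
    and h: "h \<in> lmod_end R M" and z: "z \<in> prime_radical R M"
    and hz: "h ` carrier M \<subseteq> (\<lambda>a. a \<odot>\<^bsub>M\<^esub> z) ` carrier R" and x: "x \<in> carrier M"
  shows "\<exists>k. (h ^^ k) x = \<zero>\<^bsub>M\<^esub>"
proof (rule ccontr)
  assume nz: "\<nexists>k. (h ^^ k) x = \<zero>\<^bsub>M\<^esub>"
  have zM: "z \<in> carrier M"
    using z submoduleD(2)[OF fully_invariantD(1)[OF fully_invariant_prime_radical]] by blast
  note pow = lmod_end_funpow[OF h]
  have pow_image: "\<exists>a\<in>carrier R. (h ^^ Suc k) y = a \<odot>\<^bsub>M\<^esub> (h ^^ k) z" if y: "y \<in> carrier M" for k y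
  proof -
    obtain a where "a \<in> carrier R" "h y = a \<odot>\<^bsub>M\<^esub> z" using hz y by blast
    then show ?thesis using lmod_homD(3)[OF pow _ zM] by (auto simp: funpow_swap1)
  qed
  \<comment> \<open>\<open>h^(k+1) x\<close> is a multiple of \<open>h^k z\<close>, so a zero in the
    orbit of \<open>z\<close> would force one in the orbit of \<open>x\<close>.\<close>
  have nz': "(h ^^ k) z \<noteq> \<zero>\<^bsub>M\<^esub>" for k
    using pow_image[OF x, of k] nz smult_zero_right by metis
  \<comment> \<open>Applying \<open>h^(e+1)\<close> to \<open>h^e z\<close> gives the exponent
    \<open>2e + 1\<close>; starting from 0 this produces \<open>2^n - 1\<close>.\<close>
  define w where "w n = (h ^^ (2 ^ n - 1)) z" for n
  obtain P where "prime_submodule P R M" "w 0 \<notin> P"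
  proof (rule prime_submodule_avoiding_sequence[OF proj, of w])
    fix n A B
    assume A: "fully_invariant A R M" and B: "fully_invariant B R M" and w: "w n \<in> A" "w n \<in> B"
    have n: "(2::nat) ^ n = Suc (2 ^ n - 1)" by simp
    have "(h ^^ (2 ^ n)) y \<in> B" if "y \<in> carrier M" for y
      using pow_image[OF that, of "2 ^ n - 1"] w(2) submoduleD(5)[OF fully_invariantD(1)[OF B]]
      unfolding n[symmetric] w_def by auto
    then have "(h ^^ (2 ^ n)) (w n) \<in> submodule_prod R M A B"
      using A B w(1) pow by (intro submodule_prod_memI) (auto dest!: fully_invariantD(1) submoduleD(1))
    moreover have "(h ^^ (2 ^ n)) (w n) = w (Suc n)"
    proof -
      have "2 ^ n + (2 ^ n - 1) = (2 ^ Suc n - 1 :: nat)" by simp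
      then show ?thesis unfolding w_def by (metis comp_apply funpow_add)
    qed
    ultimately show "w (Suc n) \<in> submodule_prod R M A B" by simp
  qed (use nz' lmod_homD(1)[OF pow zM] in \<open>auto simp: w_def\<close>)
  then show False using z by (auto simp: w_def prime_radical_def)
qed

end

section \<open>Finite uniform dimension\<close>

lemma ascending_chain_condition_maximal:
  assumes acc: "ascending_chain_condition \<F>" and "\<G> \<subseteq> \<F>" "\<G> \<noteq> {}"
  shows "\<exists>K\<in>\<G>. \<forall>L\<in>\<G>. K \<subseteq> L \<longrightarrow> L = K"
proof (rule ccontr)
  assume "\<not> ?thesis"
  then have "\<forall>K\<in>\<G>. \<exists>L. L \<in> \<G> \<and> K \<subset> L" by blast
  then obtain up where up: "\<And>K. K \<in> \<G> \<Longrightarrow> up K \<in> \<G> \<and> K \<subset> up K" by metis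
  obtain K0 where "K0 \<in> \<G>" using \<open>\<G> \<noteq> {}\<close> by blast
  define D where "D n = (up ^^ n) K0" for n
  have D: "D n \<in> \<G>" for n
    using \<open>K0 \<in> \<G>\<close> up by (induction n) (auto simp: D_def)
  have D_Suc: "D n \<subset> D (Suc n)" for n
    using up[OF D[of n]] by (simp add: D_def)
  obtain n where "\<forall>m\<ge>n. D m = D n"
    using acc D \<open>\<G> \<subseteq> \<F>\<close> D_Suc unfolding ascending_chain_condition_def
    by (meson psubset_imp_subset subsetD)
  then have "D (Suc n) = D n" using le_SucI by blast
  then show False using D_Suc[of n] by simp
qed

section \<open>Sums of uniform submodules\<close>

context left_module
begin

lemma submodule_nonzero_iff:
  assumes "submodule K R M"
  shows "K \<noteq> {\<zero>\<^bsub>M\<^esub>} \<longleftrightarrow> (\<exists>x\<in>K. x \<noteq> \<zero>\<^bsub>M\<^esub>)"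
  using submoduleD(3)[OF assms] by blast

text \<open>\<open>R u\<close> is a nonzero submodule of \<open>U\<close> and therefore meets
  \<open>Y \<inter> U\<close>. The form with a scalar can be composed over several summands.\<close>

lemma uniform_submodule_smult:
  assumes U: "uniform_submodule U R M" and Y: "submodule Y R M" "Y \<inter> U \<noteq> {\<zero>\<^bsub>M\<^esub>}"
    and u: "u \<in> U" "u \<noteq> \<zero>\<^bsub>M\<^esub>"
  shows "\<exists>a\<in>carrier R. a \<odot>\<^bsub>M\<^esub> u \<in> Y \<and> a \<odot>\<^bsub>M\<^esub> u \<noteq> \<zero>\<^bsub>M\<^esub>"
proof -
  let ?A = "(\<lambda>a. a \<odot>\<^bsub>M\<^esub> u) ` carrier R"
  have Us: "submodule U R M" using U by (simp add: uniform_submodule_def)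
  have uM: "u \<in> carrier M" using submoduleD(2)[OF Us u(1)] .
  have A: "submodule ?A R M" by (rule submodule_cyclic[OF uM])
  have "\<one> \<odot>\<^bsub>M\<^esub> u \<in> ?A" by (rule imageI) simp
  then have "?A \<noteq> {\<zero>\<^bsub>M\<^esub>}" using u(2) uM by auto
  moreover have "?A \<subseteq> U" using submoduleD(5)[OF Us _ u(1)] by blast
  moreover have YU: "submodule (Y \<inter> U) R M" by (rule submodule_Int[OF Y(1) Us])
  ultimately have "?A \<inter> (Y \<inter> U) \<noteq> {\<zero>\<^bsub>M\<^esub>}"
    using U A Y(2) unfolding uniform_submodule_def by (metis Int_lower2)
  then show ?thesis
    using submodule_nonzero_iff[OF submodule_Int[OF A YU]] by blast
qed

text \<open>Essentiality passes to direct sums, here in scalar form. One scalar moves the first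
  component into \<open>Y\<close>, a second one moves the rest, and their product works because
  independence prevents the two parts from cancelling.\<close>

lemma uniform_sum_smult:
  assumes U: "\<And>i. i \<in> I \<Longrightarrow> uniform_submodule (U i) R M"
    and indep: "\<And>i. i \<in> I \<Longrightarrow> U i \<inter> submodule_sum M (I - {i}) U = {\<zero>\<^bsub>M\<^esub>}"
    and Y: "submodule Y R M" and meets: "\<And>i. i \<in> I \<Longrightarrow> Y \<inter> U i \<noteq> {\<zero>\<^bsub>M\<^esub>}"
    and x: "x \<in> submodule_sum M I U" "x \<noteq> \<zero>\<^bsub>M\<^esub>"
  shows "\<exists>a\<in>carrier R. a \<odot>\<^bsub>M\<^esub> x \<in> Y \<and> a \<odot>\<^bsub>M\<^esub> x \<noteq> \<zero>\<^bsub>M\<^esub>"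
proof -
  have Us: "submodule (U i) R M" if "i \<in> I" for i using U[OF that] by (simp add: uniform_submodule_def)
  have main: "\<exists>a\<in>carrier R. a \<odot>\<^bsub>M\<^esub> (\<Oplus>\<^bsub>M\<^esub>i\<in>F. y i) \<in> Y \<and> a \<odot>\<^bsub>M\<^esub> (\<Oplus>\<^bsub>M\<^esub>i\<in>F. y i) \<noteq> \<zero>\<^bsub>M\<^esub>"
    if "finite F" "F \<subseteq> I" "\<forall>i\<in>F. y i \<in> U i" "(\<Oplus>\<^bsub>M\<^esub>i\<in>F. y i) \<noteq> \<zero>\<^bsub>M\<^esub>" for F y
    using that
  proof (induction F arbitrary: y rule: finite_induct)
    case (insert i F)
    have i: "i \<in> I" and F: "F \<subseteq> I" "F \<subseteq> I - {i}" and yi: "y i \<in> U i"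
      using insert.prems insert.hyps by auto
    have yM: "y j \<in> carrier M" if "j \<in> insert i F" for j
      using that insert.prems(1,2) submoduleD(2)[OF Us] by blast
    let ?s = "\<Oplus>\<^bsub>M\<^esub>j\<in>F. y j"
    have sM: "?s \<in> carrier M" using yM by (intro M.finsum_closed) auto
    have eq: "(\<Oplus>\<^bsub>M\<^esub>j\<in>insert i F. y j) = y i \<oplus>\<^bsub>M\<^esub> ?s"
      using yM insert.hyps by (intro M.finsum_insert) auto
    define T where "T = submodule_sum M (I - {i}) U"
    have T: "submodule T R M" unfolding T_def using Us by (intro submodule_submodule_sum) auto
    have sT: "?s \<in> T"
      using F(2) insert.prems(2) insert.hyps(1) unfolding T_def submodule_sum_def
      by (intro CollectI exI[of _ F] exI[of _ y]) auto
    show ?case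
    proof (cases "y i = \<zero>\<^bsub>M\<^esub>")
      case True
      then have "(\<Oplus>\<^bsub>M\<^esub>j\<in>insert i F. y j) = ?s" using eq sM by simp
      then show ?thesis using insert.IH insert.prems F(1) by simp
    next
      case False
      obtain a where a: "a \<in> carrier R" "a \<odot>\<^bsub>M\<^esub> y i \<in> Y" "a \<odot>\<^bsub>M\<^esub> y i \<noteq> \<zero>\<^bsub>M\<^esub>"
        using uniform_submodule_smult[OF U[OF i] Y meets[OF i] yi False] by blast
      have a_eq: "a \<odot>\<^bsub>M\<^esub> (\<Oplus>\<^bsub>M\<^esub>j\<in>insert i F. y j) = a \<odot>\<^bsub>M\<^esub> y i \<oplus>\<^bsub>M\<^esub> a \<odot>\<^bsub>M\<^esub> ?s"
        unfolding eq using a(1) yM sM by (intro smult_r_distr) auto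
      show ?thesis
      proof (cases "a \<odot>\<^bsub>M\<^esub> ?s = \<zero>\<^bsub>M\<^esub>")
        case True
        then show ?thesis using a_eq a yM[of i] by (intro bexI[of _ a]) auto
      next
        case False
        have as: "(\<Oplus>\<^bsub>M\<^esub>j\<in>F. a \<odot>\<^bsub>M\<^esub> y j) = a \<odot>\<^bsub>M\<^esub> ?s"
          using insert.hyps yM a(1) by (intro finsum_smult) auto
        have "\<forall>j\<in>F. a \<odot>\<^bsub>M\<^esub> y j \<in> U j"
          using insert.prems(2) F(1) a(1) submoduleD(5)[OF Us] by auto
        \<comment> \<open>The hypothesis is applied to the family already multiplied by
          \<open>a\<close>, so \<open>b\<close> acts after \<open>a\<close>. Multiplying the first
          component by \<open>b\<close> keeps it in \<open>Y\<close>, although it may become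
          zero.\<close>
        then obtain b where b: "b \<in> carrier R" "b \<odot>\<^bsub>M\<^esub> (a \<odot>\<^bsub>M\<^esub> ?s) \<in> Y"
          "b \<odot>\<^bsub>M\<^esub> (a \<odot>\<^bsub>M\<^esub> ?s) \<noteq> \<zero>\<^bsub>M\<^esub>"
          using insert.IH[of "\<lambda>j. a \<odot>\<^bsub>M\<^esub> y j"] F(1) False unfolding as by blast
        define u t where "u = b \<odot>\<^bsub>M\<^esub> (a \<odot>\<^bsub>M\<^esub> y i)" and "t = b \<odot>\<^bsub>M\<^esub> (a \<odot>\<^bsub>M\<^esub> ?s)"
        have u: "u \<in> U i" "u \<in> Y" and t: "t \<in> T" "t \<in> Y" "t \<noteq> \<zero>\<^bsub>M\<^esub>"
          using submoduleD(5)[OF Us[OF i]] submoduleD(5)[OF T] submoduleD(5)[OF Y] a b yi sT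
          by (simp_all add: u_def t_def)
        have ut: "u \<in> carrier M" "t \<in> carrier M"
          using submoduleD(2)[OF Y] u t by simp_all
        have ba: "(b \<otimes> a) \<odot>\<^bsub>M\<^esub> (\<Oplus>\<^bsub>M\<^esub>j\<in>insert i F. y j) = u \<oplus>\<^bsub>M\<^esub> t"
          using a(1) b(1) a_eq eq yM[of i] sM
          by (simp add: u_def t_def smult_assoc1 smult_r_distr)
        have "u \<oplus>\<^bsub>M\<^esub> t \<noteq> \<zero>\<^bsub>M\<^esub>"
        proof
          assume "u \<oplus>\<^bsub>M\<^esub> t = \<zero>\<^bsub>M\<^esub>"
          then have "u = \<ominus>\<^bsub>M\<^esub> t" using ut M.minus_equality[of u t] by simp
          then have "u \<in> U i \<inter> T" using u t submoduleD(6)[OF T] by simp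
          then have "u = \<zero>\<^bsub>M\<^esub>" using indep[OF i] unfolding T_def by blast
          then show False using \<open>u \<oplus>\<^bsub>M\<^esub> t = \<zero>\<^bsub>M\<^esub>\<close> t(3) ut by simp
        qed
        then show ?thesis
          using ba a(1) b(1) submoduleD(4)[OF Y u(2) t(2)] by (intro bexI[of _ "b \<otimes> a"]) auto
      qed
    qed
  qed simp
  show ?thesis
    using x main unfolding submodule_sum_def by blast
qed

text \<open>Choose a maximal set \<open>H\<close> of indices such that the sum of the \<open>U i\<close> with \<open>i \<in> H\<close> meets some
  tail of the family trivially.  The sum of these \<open>U i\<close> and the next tail then meets every
  \<open>U i\<close>, so it is essential, which is impossible.\<close>

theorem finite_uniform_dimension_no_infinite_direct_sum:
  fixes V :: "nat \<Rightarrow> 'c set"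
  assumes fud: "finite_uniform_dimension R M"
    and V: "\<And>k. submodule (V k) R M" "\<And>k. V k \<noteq> {\<zero>\<^bsub>M\<^esub>}"
    and V_indep: "\<And>k. V k \<inter> submodule_sum M {Suc k..} V = {\<zero>\<^bsub>M\<^esub>}"
  shows False
proof -
  obtain n :: nat and U where U: "\<And>i. i < n \<Longrightarrow> uniform_submodule (U i) R M"
    and indep: "\<And>i. i < n \<Longrightarrow> U i \<inter> submodule_sum M ({..<n} - {i}) U = {\<zero>\<^bsub>M\<^esub>}"
    and ess: "essential_submodule (submodule_sum M {..<n} U) R M"
    using fud unfolding finite_uniform_dimension_def has_uniform_dimension_def by blast
  have Us: "submodule (U i) R M" "U i \<noteq> {\<zero>\<^bsub>M\<^esub>}" if "i < n" for i
    using U[OF that] by (simp_all add: uniform_submodule_def)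
  define W where "W k = submodule_sum M {k..} V" for k
  define UH where "UH H = submodule_sum M H U" for H
  have W: "submodule (W k) R M" for k
    unfolding W_def by (intro submodule_submodule_sum V)
  have UH: "submodule (UH H) R M" if "H \<subseteq> {..<n}" for H
    unfolding UH_def using that Us(1) by (intro submodule_submodule_sum) auto
  have VW: "V j \<subseteq> W k" if "k \<le> j" for j k
    unfolding W_def by (rule submodule_sum_upper) (use that submoduleD(1)[OF V(1)] in auto)
  have W_Suc: "W (Suc k) \<subseteq> W k" for k
    unfolding W_def[of "Suc k"] by (rule submodule_sum_subset[OF W]) (use VW in auto)
  define \<H> where "\<H> = {H. H \<subseteq> {..<n} \<and> (\<exists>k. W k \<inter> UH H = {\<zero>\<^bsub>M\<^esub>})}"
  have "UH {} = {\<zero>\<^bsub>M\<^esub>}" by (auto simp: UH_def submodule_sum_def)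
  then have "{} \<in> \<H>" using submoduleD(3)[OF W] by (auto simp: \<H>_def)
  moreover have "finite \<H>" by (rule finite_subset[of _ "Pow {..<n}"]) (auto simp: \<H>_def)
  ultimately obtain H where H\<H>: "H \<in> \<H>" and H_max: "\<And>H'. \<lbrakk>H' \<in> \<H>; H \<subseteq> H'\<rbrakk> \<Longrightarrow> H = H'"
    using finite_has_maximal[of \<H>] by (metis empty_iff)
  obtain k where H: "H \<subseteq> {..<n}" and k: "W k \<inter> UH H = {\<zero>\<^bsub>M\<^esub>}" using H\<H> by (auto simp: \<H>_def)
  \<comment> \<open>The tail in \<open>Y\<close> starts one index later than the one chosen for
    \<open>H\<close>: \<open>V k\<close> is left out and provides the contradiction at the
    end.\<close>
  define Y where "Y = {w \<oplus>\<^bsub>M\<^esub> h | w h. w \<in> W (Suc k) \<and> h \<in> UH H}"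
  note Y = submodule_set_add[OF W UH[OF H], of "Suc k", folded Y_def]
  have meets: "Y \<inter> U i \<noteq> {\<zero>\<^bsub>M\<^esub>}" if i: "i < n" for i
  proof (cases "i \<in> H")
    case True
    then have "U i \<subseteq> UH H"
      unfolding UH_def by (rule submodule_sum_upper) (use submoduleD(1)[OF Us(1)[OF i]] in auto)
    then have "Y \<inter> U i = U i" using Y(3) by blast
    then show ?thesis using Us(2)[OF i] by simp
  next
    case False
    have iH: "insert i H \<subseteq> {..<n}" using i H by simp
    \<comment> \<open>Adding \<open>i\<close> destroys the trivial intersection for every tail, in
      particular for the one starting at \<open>Suc k\<close>. The \<open>U i\<close>-part of a
      common nonzero element is then a nonzero element of \<open>Y\<close>.\<close>
    have "insert i H \<notin> \<H>" using H_max[of "insert i H"] False by blast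
    then have "W (Suc k) \<inter> UH (insert i H) \<noteq> {\<zero>\<^bsub>M\<^esub>}" using iH by (auto simp: \<H>_def)
    then obtain w where w: "w \<in> W (Suc k)" "w \<in> UH (insert i H)" "w \<noteq> \<zero>\<^bsub>M\<^esub>"
      using submodule_nonzero_iff[OF submodule_Int[OF W UH[OF iH]]] by blast
    note add = submodule_set_add[OF UH[OF H] Us(1)[OF i]]
    have "UH (insert i H) \<subseteq> {h \<oplus>\<^bsub>M\<^esub> u | h u. h \<in> UH H \<and> u \<in> U i}"
      unfolding UH_def[of "insert i H"]
    proof (rule submodule_sum_subset[OF add(1)])
      fix j assume "j \<in> insert i H"
      then consider "j = i" | "j \<in> H" by blast
      then show "U j \<subseteq> {h \<oplus>\<^bsub>M\<^esub> u | h u. h \<in> UH H \<and> u \<in> U i}"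
      proof cases
        case 2
        then have "U j \<subseteq> UH H"
          unfolding UH_def by (rule submodule_sum_upper) (use 2 H submoduleD(1)[OF Us(1)] in auto)
        then show ?thesis using add(2) by (rule order_trans)
      qed (use add(3) in simp)
    qed
    then obtain h u where hu: "h \<in> UH H" "u \<in> U i" "w = h \<oplus>\<^bsub>M\<^esub> u" using w(2) by blast
    have c: "h \<in> carrier M" "u \<in> carrier M"
      using hu submoduleD(2)[OF UH[OF H]] submoduleD(2)[OF Us(1)[OF i]] by auto
    have "u = w \<oplus>\<^bsub>M\<^esub> \<ominus>\<^bsub>M\<^esub> h"
    proof -
      have "h \<oplus>\<^bsub>M\<^esub> u \<oplus>\<^bsub>M\<^esub> \<ominus>\<^bsub>M\<^esub> h = u \<oplus>\<^bsub>M\<^esub> (h \<oplus>\<^bsub>M\<^esub> \<ominus>\<^bsub>M\<^esub> h)"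
        using c by (simp add: M.add.m_ac)
      then show ?thesis using c hu(3) by (simp add: M.r_neg)
    qed
    then have "u \<in> Y" using w(1) submoduleD(6)[OF UH[OF H] hu(1)] unfolding Y_def by blast
    moreover have "u \<noteq> \<zero>\<^bsub>M\<^esub>"
    proof
      assume "u = \<zero>\<^bsub>M\<^esub>"
      then have "w = h" using hu(3) c by simp
      then have "w \<in> W k \<inter> UH H" using w(1) hu(1) W_Suc by blast
      then show False using k w(3) by simp
    qed
    ultimately show ?thesis using hu(2) by blast
  qed
  define E where "E = submodule_sum M {..<n} U"
  have E: "submodule E R M" using ess by (simp add: E_def essential_submodule_def)
  have "E \<inter> V k \<noteq> {\<zero>\<^bsub>M\<^esub>}" using ess V unfolding E_def essential_submodule_def by blast
  then obtain e where e: "e \<in> E" "e \<in> V k" "e \<noteq> \<zero>\<^bsub>M\<^esub>"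
    using submodule_nonzero_iff[OF submodule_Int[OF E V(1)]] by blast
  obtain a where a: "a \<in> carrier R" "a \<odot>\<^bsub>M\<^esub> e \<in> Y" "a \<odot>\<^bsub>M\<^esub> e \<noteq> \<zero>\<^bsub>M\<^esub>"
    using uniform_sum_smult[of "{..<n}" U Y e] U indep Y(1) meets e(1,3) by (auto simp: E_def)
  obtain w h where wh: "w \<in> W (Suc k)" "h \<in> UH H" "a \<odot>\<^bsub>M\<^esub> e = w \<oplus>\<^bsub>M\<^esub> h"
    using a(2) unfolding Y_def by blast
  have aeV: "a \<odot>\<^bsub>M\<^esub> e \<in> V k" by (rule submoduleD(5)[OF V(1) a(1) e(2)])
  have c: "w \<in> carrier M" "h \<in> carrier M"
    using wh submoduleD(2)[OF UH[OF H]] submoduleD(2)[OF W] by auto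
  \<comment> \<open>Rearranging puts \<open>h\<close> into \<open>W k \<inter> UH H\<close>, so
    \<open>h\<close> vanishes and a nonzero multiple of \<open>e\<close> lies both in
    \<open>V k\<close> and in the tail after it.\<close>
  have "h = \<ominus>\<^bsub>M\<^esub> w \<oplus>\<^bsub>M\<^esub> a \<odot>\<^bsub>M\<^esub> e"
    using c wh(3) by (simp add: M.a_assoc[symmetric] M.l_neg)
  moreover have "\<ominus>\<^bsub>M\<^esub> w \<in> W k" using submoduleD(6)[OF W wh(1)] W_Suc by blast
  moreover have "a \<odot>\<^bsub>M\<^esub> e \<in> W k" using aeV VW by blast
  ultimately have "h \<in> W k \<inter> UH H" using submoduleD(4)[OF W] wh(2) by simp
  then have "a \<odot>\<^bsub>M\<^esub> e = w" using k wh(3) c by simp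
  then have "a \<odot>\<^bsub>M\<^esub> e \<in> V k \<inter> submodule_sum M {Suc k..} V"
    using aeV wh(1) by (simp add: W_def)
  then show False using V_indep a(3) by simp
qed

end

section \<open>Nil sets of endomorphisms of a Goldie module\<close>

text \<open>For \<open>C\<close> consisting of endomorphisms, stage \<open>j\<close> consists of the
  elements killed by all products of \<open>j\<close> maps from \<open>C\<close>. The recursion
  makes each stage a common preimage of the previous one, which keeps it among the kernel
  intersections.\<close>

primrec iterated_annihilator ::
  "('r, 'm, 'y) module_scheme \<Rightarrow> ('m \<Rightarrow> 'm) set \<Rightarrow> nat \<Rightarrow> 'm set"
  where
    "iterated_annihilator M C 0 = {\<zero>\<^bsub>M\<^esub>}"
  | "iterated_annihilator M C (Suc j) = {x \<in> carrier M. \<forall>f\<in>C. f x \<in> iterated_annihilator M C j}"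

text \<open>If \<open>X\<close> cuts out \<open>L\<close>, the composites of \<open>X\<close> after
  \<open>C\<close> cut out the common preimage. Hence the chain condition also governs kernels
  modulo \<open>L\<close>.\<close>

lemma kernel_intersections_preimage:
  assumes "L \<in> kernel_intersections R M" and C: "C \<subseteq> lmod_end R M"
  shows "{x \<in> carrier M. \<forall>f\<in>C. f x \<in> L} \<in> kernel_intersections R M"
proof -
  obtain X where X: "X \<subseteq> lmod_end R M" "L = {x \<in> carrier M. \<forall>g\<in>X. g x = \<zero>\<^bsub>M\<^esub>}"
    using assms(1) by (auto simp: kernel_intersections_def)
  define X' where "X' = (\<lambda>(g, f). g \<circ> f) ` (X \<times> C)"
  have "X' \<subseteq> lmod_end R M"
    using X(1) C by (auto simp: X'_def intro!: lmod_hom_comp)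
  moreover have "{x \<in> carrier M. \<forall>f\<in>C. f x \<in> L} = {x \<in> carrier M. \<forall>h\<in>X'. h x = \<zero>\<^bsub>M\<^esub>}"
    using C by (auto simp: X(2) X'_def lmod_homD(1))
  ultimately show ?thesis unfolding kernel_intersections_def by blast
qed

context left_module
begin

lemma zero_in_kernel_intersections: "{\<zero>\<^bsub>M\<^esub>} \<in> kernel_intersections R M"
  unfolding kernel_intersections_def
  by (rule CollectI, rule exI[of _ "{id}"]) (auto simp: id_in_lmod_end)

context
  fixes C :: "('c \<Rightarrow> 'c) set"
  assumes C: "C \<subseteq> lmod_end R M"
    and C_right: "\<And>f s. \<lbrakk>f \<in> C; s \<in> lmod_end R M\<rbrakk> \<Longrightarrow> f \<circ> s \<in> C"
begin

lemma iterated_annihilator_kernel: "iterated_annihilator M C j \<in> kernel_intersections R M"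
  by (induction j) (simp_all add: zero_in_kernel_intersections kernel_intersections_preimage C)

lemma submodule_iterated_annihilator: "submodule (iterated_annihilator M C j) R M"
proof (induction j)
  case (Suc j)
  have "submodule {x \<in> carrier M. f x \<in> iterated_annihilator M C j} R M" if "f \<in> C" for f
    using submodule_preimage[OF subsetD[OF C that] Suc] .
  note D = submoduleD(3-5)[OF this]
  show ?case
  proof (rule submoduleI)
    show "x \<oplus>\<^bsub>M\<^esub> y \<in> iterated_annihilator M C (Suc j)"
      if "x \<in> iterated_annihilator M C (Suc j)" "y \<in> iterated_annihilator M C (Suc j)" for x y
      using that D(2)[of _ x y] by simp
    show "a \<odot>\<^bsub>M\<^esub> x \<in> iterated_annihilator M C (Suc j)"
      if "a \<in> carrier R" "x \<in> iterated_annihilator M C (Suc j)" for a x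
      using that D(3)[of _ a x] by simp
  qed (use D(1) in auto)
qed (simp add: submodule_zero)

lemma iterated_annihilator_mono: "iterated_annihilator M C j \<subseteq> iterated_annihilator M C (Suc j)"
proof (induction j)
  case 0
  have "f \<zero>\<^bsub>M\<^esub> = \<zero>\<^bsub>M\<^esub>" if "f \<in> C" for f using that C lmod_end_zero by blast
  then show ?case by auto
qed auto

text \<open>In a product of maps from \<open>C\<close> applied to \<open>s x\<close>, the innermost
  factor absorbs \<open>s\<close>, so a case distinction on \<open>j\<close> replaces an
  induction.\<close>

lemma iterated_annihilator_invariant:
  assumes "s \<in> lmod_end R M" "x \<in> iterated_annihilator M C j"
  shows "s x \<in> iterated_annihilator M C j"
proof (cases j)
  case 0
  then show ?thesis using assms lmod_end_zero by simp
next
  case (Suc i)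
  have "f (s x) \<in> iterated_annihilator M C i" if "f \<in> C" for f
    using C_right[OF that assms(1)] assms(2) Suc by auto
  then show ?thesis using assms lmod_homD(1) Suc by auto
qed

end

text \<open>Lanski's argument.  Let \<open>K\<close> be the largest iterated annihilator, and assume \<open>K \<noteq> M\<close>.  Choose
  \<open>a\<^sub>n \<in> C\<close> recursively such that \<open>b\<^sub>n\<^sub>+\<^sub>1 = a\<^sub>n \<circ> b\<^sub>n\<close> does not map \<open>M\<close> into \<open>K\<close> and the preimage of \<open>K\<close>
  under \<open>a\<^sub>n\<close> is maximal.  Nilpotency forces \<open>a\<^sub>n \<circ> b\<^sub>m\<close> to map \<open>M\<close> into \<open>K\<close> for \<open>m > n\<close>, while the
  kernels of the \<open>b\<^sub>n\<close> become stationary, so the images of the \<open>b\<^sub>n\<close> eventually form an infinite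
  direct sum.\<close>

theorem iterated_annihilator_eq_carrier:
  assumes goldie: "goldie_module R M"
    and C: "C \<subseteq> lmod_end R M"
    and C_right: "\<And>f s. \<lbrakk>f \<in> C; s \<in> lmod_end R M\<rbrakk> \<Longrightarrow> f \<circ> s \<in> C"
    and C_left: "\<And>f s. \<lbrakk>f \<in> C; s \<in> lmod_end R M\<rbrakk> \<Longrightarrow> s \<circ> f \<in> C"
    and nil: "\<And>f x. \<lbrakk>f \<in> C; x \<in> carrier M\<rbrakk> \<Longrightarrow> \<exists>k. (f ^^ k) x = \<zero>\<^bsub>M\<^esub>"
  shows "\<exists>p. iterated_annihilator M C p = carrier M"
proof (rule ccontr)
  assume no_p: "\<nexists>p. iterated_annihilator M C p = carrier M"
  have acc: "ascending_chain_condition (kernel_intersections R M)"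
    and fud: "finite_uniform_dimension R M"
    using goldie by (simp_all add: goldie_module_def)
  note kernel = iterated_annihilator_kernel[OF C C_right]
    and mono = iterated_annihilator_mono[OF C C_right]
    and invariant = iterated_annihilator_invariant[OF C C_right]
    and ann_submodule = submodule_iterated_annihilator[OF C C_right]
  obtain p where p: "\<And>m. p \<le> m \<Longrightarrow> iterated_annihilator M C m = iterated_annihilator M C p"
    using acc kernel mono unfolding ascending_chain_condition_def by meson
  define K where "K = iterated_annihilator M C p"
  \<comment> \<open>Stationarity at \<open>p\<close> says that \<open>M/K\<close> has no nonzero
    element annihilated by \<open>C\<close>; this keeps the recursion below going.\<close>
  have K_Suc: "x \<in> K" if "x \<in> carrier M" "\<And>f. f \<in> C \<Longrightarrow> f x \<in> K" for x
    using that p[of "Suc p"] unfolding K_def by auto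
  have K: "submodule K R M" "K \<in> kernel_intersections R M"
    using ann_submodule[of p] kernel[of p] by (simp_all add: K_def)
  have K_inv: "s x \<in> K" if "s \<in> lmod_end R M" "x \<in> K" for s x
    using invariant that unfolding K_def by blast
  have K_ne: "\<exists>x\<in>carrier M. x \<notin> K"
    using no_p submoduleD(1)[OF K(1)] unfolding K_def by blast
  have C_end: "f \<in> lmod_end R M" if "f \<in> C" for f using that C by blast
  \<comment> \<open>From here \<open>K\<close> plays the role of zero: \<open>live\<close> means
    nonzero as a map into \<open>M/K\<close>, and \<open>ker\<close> is the kernel of that
    map.\<close>
  define live where "live g \<longleftrightarrow> g \<in> lmod_end R M \<and> (\<exists>x\<in>carrier M. g x \<notin> K)" for g
  define ker where "ker g = {x \<in> carrier M. g x \<in> K}" for g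
  have ker: "ker g \<in> kernel_intersections R M" if "g \<in> lmod_end R M" for g
    using kernel_intersections_preimage[OF K(2), of "{g}"] that by (simp add: ker_def)
  have "\<exists>a. a \<in> C \<and> live (a \<circ> b) \<and> (\<forall>a'\<in>C. live (a' \<circ> b) \<and> ker a \<subseteq> ker a' \<longrightarrow> ker a' = ker a)"
    if b: "live b" for b
  proof -
    obtain x where x: "x \<in> carrier M" "b x \<notin> K" and be: "b \<in> lmod_end R M"
      using b by (auto simp: live_def)
    obtain f where f: "f \<in> C" "f (b x) \<notin> K"
      using K_Suc[of "b x"] lmod_homD(1)[OF be x(1)] x(2) by blast
    have "live (f \<circ> b)"
      using f x lmod_hom_comp[OF C_end[OF f(1)] be] by (auto simp: live_def)
    then have ne: "ker ` {a \<in> C. live (a \<circ> b)} \<noteq> {}" using f(1) by blast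
    have sub: "ker ` {a \<in> C. live (a \<circ> b)} \<subseteq> kernel_intersections R M"
      using ker[OF C_end] by auto
    have "\<exists>L\<in>ker ` {a \<in> C. live (a \<circ> b)}. \<forall>L'\<in>ker ` {a \<in> C. live (a \<circ> b)}. L \<subseteq> L' \<longrightarrow> L' = L"
      by (rule ascending_chain_condition_maximal[OF acc sub ne])
    then show ?thesis by auto
  qed
  then have "\<forall>b. \<exists>a. live b \<longrightarrow> a \<in> C \<and> live (a \<circ> b) \<and>
      (\<forall>a'\<in>C. live (a' \<circ> b) \<and> ker a \<subseteq> ker a' \<longrightarrow> ker a' = ker a)"
    by simp
  then obtain pick where pick_all: "\<forall>b. live b \<longrightarrow> pick b \<in> C \<and> live (pick b \<circ> b) \<and>
      (\<forall>a'\<in>C. live (a' \<circ> b) \<and> ker (pick b) \<subseteq> ker a' \<longrightarrow> ker a' = ker (pick b))"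
    unfolding choice_iff by (elim exE)
  have pick: "pick b \<in> C" "live (pick b \<circ> b)" if "live b" for b
    using pick_all that by simp_all
  have pick_max: "ker a' = ker (pick b)"
    if "live b" "a' \<in> C" "live (a' \<circ> b)" "ker (pick b) \<subseteq> ker a'" for b a'
    using pick_all that by simp
  define b where "b = rec_nat id (\<lambda>_ b. pick b \<circ> b)"
  define a where "a n = pick (b n)" for n
  have b_Suc: "b (Suc n) = a n \<circ> b n" for n by (simp add: a_def b_def)
  have live: "live (b n)" for n
  proof (induction n)
    case 0
    then show ?case using K_ne by (simp add: b_def live_def id_in_lmod_end[unfolded id_def])
  next
    case (Suc n)
    then show ?case using pick(2) by (simp only: b_Suc a_def)
  qed
  have aC: "a n \<in> C" for n using pick(1)[OF live] by (simp add: a_def)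
  note aE = C_end[OF aC]
  have bE: "b n \<in> lmod_end R M" for n using live[of n] by (simp add: live_def)
  \<comment> \<open>It is \<open>w \<circ> a n\<close>, not \<open>w\<close>, that is claimed to lie
    in \<open>C\<close>: for \<open>m = Suc n\<close> the map \<open>w\<close> is the
    identity.\<close>
  have factor: "\<exists>w. w \<in> lmod_end R M \<and> w \<circ> a n \<in> C \<and> b m = w \<circ> a n \<circ> b n" if "n < m" for n m
  proof -
    have "Suc n \<le> m" using that by simp
    then show ?thesis
    proof (induction m rule: dec_induct)
      case base
      then show ?case
        using aC[of n] id_in_lmod_end[of R M, unfolded id_def] by (intro exI[of _ id]) (simp add: b_Suc)
    next
      case (step m)
      then obtain w where w: "w \<in> lmod_end R M" "w \<circ> a n \<in> C" "b m = w \<circ> a n \<circ> b n" by blast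
      have "a m \<circ> w \<circ> a n = a m \<circ> (w \<circ> a n)" by (rule comp_assoc)
      moreover have "a m \<circ> (w \<circ> a n) \<in> C" by (rule C_left[OF w(2) aE])
      moreover have "b (Suc m) = a m \<circ> w \<circ> a n \<circ> b n" unfolding b_Suc w(3) by (simp only: comp_assoc)
      ultimately show ?case using lmod_hom_comp[OF aE w(1)] by metis
    qed
  qed
  have dead: "a n (b m x) \<in> K" if "n < m" and x: "x \<in> carrier M" for n m x
  proof (rule ccontr)
    assume nK: "a n (b m x) \<notin> K"
    obtain w where w: "w \<in> lmod_end R M" and uC: "w \<circ> a n \<in> C" and bm: "b m = w \<circ> a n \<circ> b n"
      using factor[OF \<open>n < m\<close>] by blast
    define u where "u = w \<circ> a n"
    have uE: "u \<in> lmod_end R M" using C_end[OF uC] by (simp add: u_def)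
    have auC: "a n \<circ> u \<in> C" by (rule C_right[OF aC uE])
    have "live (a n \<circ> u \<circ> b n)"
      using nK x bm lmod_hom_comp[OF C_end[OF auC] bE[of n]] by (auto simp: live_def u_def)
    moreover have "ker (a n) \<subseteq> ker (a n \<circ> u)"
      using K_inv[OF lmod_hom_comp[OF aE w]] by (auto simp: ker_def u_def)
    ultimately have "ker (a n \<circ> u) = ker (a n)"
      using pick_max[OF live[of n] auC] by (simp add: a_def)
    \<comment> \<open>Maximality makes \<open>u\<close> injective modulo \<open>ker (a n)\<close>,
      so the orbit of \<open>v\<close> never enters \<open>ker (a n)\<close>, whereas
      \<open>u\<close> is locally nilpotent as an element of \<open>C\<close>.\<close>
    then have reflect: "a n y \<in> K" if "y \<in> carrier M" "a n (u y) \<in> K" for y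
      using that by (auto simp: ker_def)
    obtain y where y: "y \<in> carrier M" "b (Suc n) y \<notin> K" using live[of "Suc n"] by (auto simp: live_def)
    define v where "v = b n y"
    have v: "v \<in> carrier M" "a n v \<notin> K"
      using y lmod_homD(1)[OF bE] by (simp_all add: v_def b_Suc)
    have "(u ^^ k) v \<in> carrier M \<and> a n ((u ^^ k) v) \<notin> K" for k
    proof (induction k)
      case (Suc k)
      then show ?case using reflect[of "(u ^^ k) v"] lmod_homD(1)[OF uE] by auto
    qed (use v in simp)
    moreover obtain k where "(u ^^ k) v = \<zero>\<^bsub>M\<^esub>" using nil[OF uC v(1)] by (auto simp: u_def)
    ultimately show False
      using submoduleD(3)[OF K(1)] lmod_end_zero[OF aE] by metis
  qed
  \<comment> \<open>\<open>a n\<close> kills the later \<open>b m\<close> only modulo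
    \<open>K\<close>. Each further factor \<open>a (n + 1), a (n + 2), ...\<close> descends one
    annihilator, so \<open>p\<close> of them reach exact zero, while on \<open>b n\<close> the
    composite merely advances the index.\<close>
  have separate: "\<exists>d. d \<in> lmod_end R M \<and> (\<forall>x\<in>carrier M. d (b n x) = b (Suc n + j) x) \<and>
      (\<forall>m>n. \<forall>x\<in>carrier M. d (b m x) \<in> iterated_annihilator M C (p - j))" for n j
  proof (induction j)
    case 0
    then show ?case using aE[of n] dead[of n] by (intro exI[of _ "a n"]) (auto simp: b_Suc K_def)
  next
    case (Suc j)
    then obtain d where d: "d \<in> lmod_end R M" "\<And>x. x \<in> carrier M \<Longrightarrow> d (b n x) = b (Suc n + j) x"
      "\<And>m x. \<lbrakk>m > n; x \<in> carrier M\<rbrakk> \<Longrightarrow> d (b m x) \<in> iterated_annihilator M C (p - j)"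
      by blast
    let ?d = "a (Suc n + j) \<circ> d"
    have "?d (b m x) \<in> iterated_annihilator M C (p - Suc j)" if mx: "m > n" "x \<in> carrier M" for m x
    proof (cases "p - j")
      case 0
      then have "?d (b m x) = \<zero>\<^bsub>M\<^esub>" using d(3)[OF mx] lmod_end_zero[OF aE] by simp
      then show ?thesis using submoduleD(3)[OF ann_submodule] by simp
    next
      case (Suc i)
      then have "p - Suc j = i" by simp
      then show ?thesis using d(3)[OF mx] aC Suc by auto
    qed
    moreover have "?d (b n x) = b (Suc n + Suc j) x" if "x \<in> carrier M" for x
      using d(2)[OF that] by (simp add: b_Suc)
    ultimately show ?case using lmod_hom_comp[OF aE d(1)] by blast
  qed
  \<comment> \<open>These are genuine kernels, not kernels modulo \<open>K\<close>.\<close>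
  define Z where "Z n = {x \<in> carrier M. b n x = \<zero>\<^bsub>M\<^esub>}" for n
  have "Z n \<in> kernel_intersections R M" for n
    using kernel_intersections_preimage[OF zero_in_kernel_intersections, of "{b n}"] bE[of n]
    by (simp add: Z_def)
  moreover have "Z n \<subseteq> Z (Suc n)" for n
    using lmod_end_zero[OF aE] by (auto simp: Z_def b_Suc)
  ultimately obtain q where q: "\<And>n. q \<le> n \<Longrightarrow> Z n = Z q"
    using acc unfolding ascending_chain_condition_def by meson
  define V where "V k = b (q + k) ` carrier M" for k
  show False
  proof (rule finite_uniform_dimension_no_infinite_direct_sum[OF fud])
    show V: "submodule (V k) R M" for k
      unfolding V_def by (rule submodule_image[OF bE])
    show "V k \<noteq> {\<zero>\<^bsub>M\<^esub>}" for k
    proof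
      assume "V k = {\<zero>\<^bsub>M\<^esub>}"
      then have "b (q + k) x = \<zero>\<^bsub>M\<^esub>" if "x \<in> carrier M" for x
        using that by (auto simp: V_def)
      then show False
        using live[of "q + k"] submoduleD(3)[OF K(1)] by (auto simp: live_def)
    qed
    show "V k \<inter> submodule_sum M {Suc k..} V = {\<zero>\<^bsub>M\<^esub>}" for k
    proof -
      \<comment> \<open>\<open>d\<close> kills every later \<open>V i\<close> and is injective on
        \<open>V k\<close>: \<open>d \<circ> b (q + k)\<close> agrees on \<open>M\<close> with a
        later \<open>b\<close>, whose kernel is the same from \<open>q\<close> on.\<close>
      obtain d where d: "d \<in> lmod_end R M"
        "\<And>x. x \<in> carrier M \<Longrightarrow> d (b (q + k) x) = b (Suc (q + k) + p) x"
        "\<And>m x. \<lbrakk>m > q + k; x \<in> carrier M\<rbrakk> \<Longrightarrow> d (b m x) = \<zero>\<^bsub>M\<^esub>"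
        using separate[of "q + k" p] by auto
      have "submodule_sum M {Suc k..} V \<subseteq> {x \<in> carrier M. d x \<in> {\<zero>\<^bsub>M\<^esub>}}"
      proof (rule submodule_sum_subset[OF submodule_preimage[OF d(1) submodule_zero]])
        show "V i \<subseteq> {x \<in> carrier M. d x \<in> {\<zero>\<^bsub>M\<^esub>}}" if "i \<in> {Suc k..}" for i
          using that d(3)[of "q + i"] lmod_homD(1)[OF bE] by (auto simp: V_def)
      qed
      moreover have "v = \<zero>\<^bsub>M\<^esub>" if v: "v \<in> V k" "d v = \<zero>\<^bsub>M\<^esub>" for v
      proof -
        obtain x where x: "x \<in> carrier M" "v = b (q + k) x" using v(1) by (auto simp: V_def)
        then have "x \<in> Z (Suc (q + k) + p)" using d(2) v(2) by (simp add: Z_def)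
        then have "x \<in> Z (q + k)" using q[of "Suc (q + k) + p"] q[of "q + k"] by simp
        then show ?thesis using x by (simp add: Z_def)
      qed
      moreover have "\<zero>\<^bsub>M\<^esub> \<in> V k" "\<zero>\<^bsub>M\<^esub> \<in> submodule_sum M {Suc k..} V"
        by (rule submoduleD(3)[OF V]) (intro submoduleD(3) submodule_submodule_sum V)
      ultimately show ?thesis by blast
    qed
  qed
qed

end

section \<open>The prime radical\<close>

context left_module
begin

text \<open>The dual basis writes \<open>x\<close> as a finite sum of the \<open>\<phi> y x\<close>,
  and \<open>f \<circ> \<phi> y\<close> has image in \<open>R (f y)\<close> with
  \<open>f y \<in> N\<close>. Asking for membership of \<open>f x\<close> in a submodule avoids
  forming an infinite sum of endomorphisms.\<close>

lemma lmod_end_mem_of_cyclic_images: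
  assumes proj: "direct_power_projective R M"
    and f: "f \<in> lmod_end R M" "f ` carrier M \<subseteq> N" and x: "x \<in> carrier M"
    and L: "submodule L R M"
    and hL: "\<And>h z. \<lbrakk>h \<in> lmod_end R M; z \<in> N; h ` carrier M \<subseteq> (\<lambda>a. a \<odot>\<^bsub>M\<^esub> z) ` carrier R\<rbrakk> \<Longrightarrow> h x \<in> L"
  shows "f x \<in> L"
proof -
  obtain \<phi> where \<phi>: "\<forall>y\<in>carrier M. \<phi> y \<in> lmod_end R M"
    and cyc: "\<forall>y\<in>carrier M. \<forall>x\<in>carrier M. \<phi> y x \<in> (\<lambda>a. a \<odot>\<^bsub>M\<^esub> y) ` carrier R"
    and sum: "\<forall>x\<in>carrier M. finite {y \<in> carrier M. \<phi> y x \<noteq> \<zero>\<^bsub>M\<^esub>} \<and>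
      (\<Oplus>\<^bsub>M\<^esub>y\<in>{y \<in> carrier M. \<phi> y x \<noteq> \<zero>\<^bsub>M\<^esub>}. \<phi> y x) = x"
    by (rule dual_basis[OF left_module_axioms proj])
  have "f (\<phi> y x) \<in> L" if y: "y \<in> carrier M" for y
  proof -
    have "(f \<circ> \<phi> y) ` carrier M \<subseteq> (\<lambda>a. a \<odot>\<^bsub>M\<^esub> f y) ` carrier R"
    proof
      fix v assume "v \<in> (f \<circ> \<phi> y) ` carrier M"
      then obtain u where u: "u \<in> carrier M" "v = f (\<phi> y u)" by auto
      obtain a where "a \<in> carrier R" "\<phi> y u = a \<odot>\<^bsub>M\<^esub> y" using cyc u(1) y by blast
      then show "v \<in> (\<lambda>a. a \<odot>\<^bsub>M\<^esub> f y) ` carrier R"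
        using u(2) lmod_homD(3)[OF f(1) _ y] by auto
    qed
    moreover have "f y \<in> N" using f(2) y by blast
    ultimately show ?thesis
      using hL[OF lmod_hom_comp[OF f(1) bspec[OF \<phi> y]]] by simp
  qed
  \<comment> \<open>The sum is formed inside the preimage of \<open>L\<close> under
    \<open>f\<close>, so \<open>f\<close> need not be moved through \<open>finsum\<close>.\<close>
  then have "\<phi> y x \<in> {v \<in> carrier M. f v \<in> L}" if "y \<in> carrier M" for y
    using that lmod_homD(1)[OF bspec[OF \<phi> that] x] by simp
  then have "(\<Oplus>\<^bsub>M\<^esub>y\<in>{y \<in> carrier M. \<phi> y x \<noteq> \<zero>\<^bsub>M\<^esub>}. \<phi> y x) \<in> {v \<in> carrier M. f v \<in> L}"
    using sum x by (intro finsum_in_submodule submodule_preimage f(1) L) simp_all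
  then show ?thesis using sum x by simp
qed

end

theorem corollary5p5:
  fixes R :: "('r, 'x) ring_scheme" and M :: "('r, 'm, 'y) module_scheme"
  assumes "left_module R M"
    and "direct_power_projective R M"
    and "retractable R M"
    and "goldie_module R M"
  shows "nilpotent_submodule (prime_radical R M) R M"
proof -
  interpret left_module R M by fact
  define N where "N = prime_radical R M"
  have N: "fully_invariant N R M" unfolding N_def by (rule fully_invariant_prime_radical)
  note Ns = fully_invariantD(1)[OF N]
  have proj: "rel_projective R M M" by (rule rel_projective_self[OF assms(1,2)])
  define C where "C = {h \<in> lmod_end R M. \<exists>z\<in>N. h ` carrier M \<subseteq> (\<lambda>a. a \<odot>\<^bsub>M\<^esub> z) ` carrier R}"
  have C: "C \<subseteq> lmod_end R M" by (auto simp: C_def)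
  have C_right: "f \<circ> s \<in> C" if f: "f \<in> C" and s: "s \<in> lmod_end R M" for f s
  proof -
    obtain z where z: "z \<in> N" "f ` carrier M \<subseteq> (\<lambda>a. a \<odot>\<^bsub>M\<^esub> z) ` carrier R" and fe: "f \<in> lmod_end R M"
      using f by (auto simp: C_def)
    have "(f \<circ> s) ` carrier M \<subseteq> f ` carrier M" using lmod_homD(1)[OF s] by auto
    then have "(f \<circ> s) ` carrier M \<subseteq> (\<lambda>a. a \<odot>\<^bsub>M\<^esub> z) ` carrier R" using z(2) by (rule order_trans)
    then show ?thesis using lmod_hom_comp[OF fe s] z(1) unfolding C_def by blast
  qed
  \<comment> \<open>The generator of the cyclic image moves from \<open>z\<close> to
    \<open>s z\<close>, which is in \<open>N\<close> by full invariance.\<close>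
  have C_left: "s \<circ> f \<in> C" if f: "f \<in> C" and s: "s \<in> lmod_end R M" for f s
  proof -
    obtain z where z: "z \<in> N" "f ` carrier M \<subseteq> (\<lambda>a. a \<odot>\<^bsub>M\<^esub> z) ` carrier R" and fe: "f \<in> lmod_end R M"
      using f by (auto simp: C_def)
    have "(s \<circ> f) ` carrier M \<subseteq> (\<lambda>a. a \<odot>\<^bsub>M\<^esub> s z) ` carrier R"
    proof
      fix v assume "v \<in> (s \<circ> f) ` carrier M"
      then obtain u where u: "u \<in> carrier M" "v = s (f u)" by auto
      obtain a where "a \<in> carrier R" "f u = a \<odot>\<^bsub>M\<^esub> z" using z(2) u(1) by blast
      then show "v \<in> (\<lambda>a. a \<odot>\<^bsub>M\<^esub> s z) ` carrier R"
        using u(2) lmod_homD(3)[OF s _ submoduleD(2)[OF Ns z(1)]] by auto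
    qed
    moreover have "s z \<in> N" by (rule fully_invariantD(2)[OF N s z(1)])
    ultimately show ?thesis using lmod_hom_comp[OF s fe] by (auto simp: C_def)
  qed
  have "\<exists>k. (f ^^ k) x = \<zero>\<^bsub>M\<^esub>" if "f \<in> C" "x \<in> carrier M" for f x
    using that funpow_eventually_zero[OF proj] by (auto simp: C_def N_def)
  then obtain p where p: "iterated_annihilator M C p = carrier M"
    using iterated_annihilator_eq_carrier[OF assms(4) C C_right C_left] by blast
  note ann_submodule = submodule_iterated_annihilator[OF C C_right]
  \<comment> \<open>Each new factor \<open>N\<close> is an application of maps into
    \<open>N\<close>; their cyclic pieces lie in \<open>C\<close> and lower the annihilator by one
    stage. The start is \<open>N \<subseteq> M\<close>, which is stage \<open>p\<close>; truncated
    subtraction keeps the bound at stage 0 afterwards.\<close>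
  have power: "submodule_power R M N (Suc l) \<subseteq> iterated_annihilator M C (p - l)" for l
  proof (induction l)
    case 0
    then show ?case using submoduleD(1)[OF Ns] p by simp
  next
    case (Suc l)
    have "submodule_prod R M (submodule_power R M N (Suc l)) N \<subseteq> iterated_annihilator M C (p - Suc l)"
    proof (rule submodule_prod_subset[OF Ns ann_submodule])
      fix f assume f: "f \<in> lmod_end R M" "f ` carrier M \<subseteq> N"
      have "f x \<in> iterated_annihilator M C (p - Suc l)" if "x \<in> submodule_power R M N (Suc l)" for x
      proof -
        have x: "x \<in> iterated_annihilator M C (p - l)" using Suc that by blast
        have xM: "x \<in> carrier M" using submoduleD(2)[OF ann_submodule x] .
        show ?thesis
        proof (rule lmod_end_mem_of_cyclic_images[OF assms(2) f xM ann_submodule])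
          fix h z assume "h \<in> lmod_end R M" "z \<in> N" "h ` carrier M \<subseteq> (\<lambda>a. a \<odot>\<^bsub>M\<^esub> z) ` carrier R"
          then have h: "h \<in> C" by (auto simp: C_def)
          show "h x \<in> iterated_annihilator M C (p - Suc l)"
          proof (cases "p - l")
            case 0
            then have "h x = \<zero>\<^bsub>M\<^esub>" using x h C lmod_end_zero by auto
            then show ?thesis using submoduleD(3)[OF ann_submodule] by simp
          next
            case (Suc i)
            then have "p - Suc l = i" by simp
            then show ?thesis using x h Suc by simp
          qed
        qed
      qed
      then show "f ` submodule_power R M N (Suc l) \<subseteq> iterated_annihilator M C (p - Suc l)" by blast
    qed
    then show ?case by simp
  qed
  \<comment> \<open>The exponent \<open>p + 1\<close> already gives the inclusion; with one more the
    power is literally a product even for \<open>p = 0\<close>, and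
    \<open>zero_in_submodule_prod\<close> supplies the converse.\<close>
  have "submodule_power R M N (Suc (Suc p)) \<subseteq> {\<zero>\<^bsub>M\<^esub>}"
    using power[of "Suc p"] by simp
  moreover have "\<zero>\<^bsub>M\<^esub> \<in> submodule_power R M N (Suc (Suc p))"
    by (simp add: zero_in_submodule_prod)
  ultimately have "submodule_power R M N (Suc (Suc p)) = {\<zero>\<^bsub>M\<^esub>}" by blast
  then show ?thesis
    unfolding nilpotent_submodule_def N_def[symmetric] using Ns zero_less_Suc by blast
qed

end
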